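(* Let $\{\lambda_{n,l}: n\ge 1\}$, $l=1,2$, be strictly increasing sequences of positive numbers such that the (finite) limits $$a_l:=\lim_{n\to\infty}\frac{\lambda_{n,l}}{n^{1/2}},\quad l=1,2,$$ exist. Let $\theta_1,\theta_2\in[0,2\pi]$, $(t_0,\omega_0)\in\mathbb{R}^2$ and $$\Lambda=\bigcup_{l=1}^2\big\{(t_0,\omega_0)\pm\lambda_{n,l}(\sin\theta_l,\cos\theta_l): n\ge 1\big\}.$$ If $\max\{a_1,a_2\}<1$ and $(\theta_1-\theta_2)/\pi\notin\mathbb{Q}$, then $\Lambda$ does Gabor phase retrieval. Moreover, if $(\theta_1-\theta_2)/\pi\in\mathbb{Q}$ or $1/a_1^2+1/a_2^2<1/2$, then $\Lambda$ does not do Gabor phase retrieval.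
   Context: Let $\varphi(x)=e^{-\pi x^2}$, $x\in\mathbb{R}$. For $f\in L^2(\mathbb{R})$ the Gabor transform is $V_\varphi f(t,\omega)=\int_{\mathbb{R}} f(x)\varphi(x-t)e^{-2\pi i x\omega}\,dx$, $(t,\omega)\in\mathbb{R}^2$. A set $\Lambda\subset\mathbb{R}^2$ does Gabor phase retrieval if, for all $f_1,f_2\in L^2(\mathbb{R})$, the condition $|V_\varphi f_1(t,\omega)|=|V_\varphi f_2(t,\omega)|$ for all $(t,\omega)\in\Lambda$ implies that there is a real constant $\alpha$ with $f_1=e^{i\alpha}f_2$ almost everywhere. Convention: $1/a_l^2=+\infty$ if $a_l=0$. *)

theory Defs
  imports "HOL-Analysis.Analysis"
begin

(* Functions in L^2(R) are represented by Lebesgue measurable representatives,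
   with equality in L^2 expressed by almost-everywhere equality. *)
definition square_integrable :: "(real \<Rightarrow> complex) \<Rightarrow> bool" where
  "square_integrable f \<longleftrightarrow>
     f \<in> borel_measurable lebesgue \<and> integrable lebesgue (\<lambda>x. (cmod (f x))\<^sup>2)"

definition gauss :: "real \<Rightarrow> real" where
  "gauss x = exp (- pi * x\<^sup>2)"

definition gabor :: "(real \<Rightarrow> complex) \<Rightarrow> real \<times> real \<Rightarrow> complex" where
  "gabor f = (\<lambda>(t, \<omega>).
     LINT x|lebesgue. f x * complex_of_real (gauss (x - t)) * exp (- 2 * pi * \<i> * x * \<omega>))"

definition does_gabor_phase_retrieval :: "(real \<times> real) set \<Rightarrow> bool" where
  "does_gabor_phase_retrieval \<Lambda> \<longleftrightarrow>
     (\<forall>f1 f2. square_integrable f1 \<longrightarrow> square_integrable f2 \<longrightarrow>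
        (\<forall>p\<in>\<Lambda>. cmod (gabor f1 p) = cmod (gabor f2 p)) \<longrightarrow>
        (\<exists>\<alpha>::real. AE x in lebesgue. f1 x = exp (\<i> * \<alpha>) * f2 x))"

definition inv_square :: "real \<Rightarrow> ereal" where
  "inv_square a = (if a = 0 then \<infinity> else ereal (1 / a\<^sup>2))"

end

(*
With z = t - i w, the Gabor transform of f is, up to a zero-free factor depending only on (t, w),
the Bargmann transform F of f, an entire function with |F(z)| <= C exp(pi |z|^2 / 2).

Positive direction. On a line through the centre, |F1|^2 - |F2|^2 is the restriction of an entire
function G of order 2 and type pi, vanishing at the points lam_n. The function H(w) = G(sqrt w) on the
right half plane then has zeros of density 1/a^2 > 1 but exponential type at most pi, so it vanishes
(Carlson).  Hence |F1| = |F2| on both lines. The two reflection identities make F1/F2 invariant under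
a rotation of infinite order, so it is constant.

Negative direction. If S is entire with type less than pi/2, then 1 + bS and 1 - bS are Bargmann
transforms of square integrable functions.  For a rational angle take bS a multiple of a power of z
that is imaginary on both lines; if the points are sparse take S = prod (1 - (z/(e_l lam_{n,l}))^4),
where the additional zeros on the perpendicular lines keep the order-2 type finite, namely
pi (1/a_1^2 + 1/a_2^2).
*)

theory Submission
  imports Defs "HOL-Probability.Probability" "HOL-Complex_Analysis.Complex_Analysis"
begin

subsection \<open>Zeros in a half disc and a Carlson-type theorem\<close>

text \<open>The threshold \<open>a l < 1\<close> is that of Carlson's theorem: sin (pi w) has
  exponential type pi and zeros of density exactly 1, and G has type pi because it multiplies a
  Bargmann transform by its reflection, each of type pi / 2. Carlson's theorem is proved
  quantitatively: finite Blaschke products on half discs of growing radius need only the maximum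
  modulus principle.

  In the negative direction, |1 + bS| = |1 - bS| holds exactly where bS is imaginary, zero included.
  The bound 1 / 2 is the type pi / 2 of Bargmann transforms; a strictly smaller type leaves room for
  Gaussian decay, so that the preimage is an absolutely convergent integral.

  Fourth powers are forced: if lam_n^2 is asymptotic to a^2 n with a > 0, the sum of 1 / lam_n^2
  diverges and so does the product of the 1 - (z / (e lam_n))^2. The zeros at i e lam_n supply
  factors whose quadratic terms cancel these, and the sum of 1 / lam_n^4 converges. For lam_n = a
  sqrt n and e = 1 the product is sin (pi z^2 / a^2) / (pi z^2 / a^2), which shows the type pi /
  a^2.\<close>

definition half_disc :: "real \<Rightarrow> complex set" where
  "half_disc R = {w. 0 < Re w \<and> cmod w < R}"

definition closed_half_disc :: "real \<Rightarrow> complex set" where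
  "closed_half_disc R = {w. 0 \<le> Re w \<and> cmod w \<le> R}"

text \<open>The Blaschke factor of the half disc: it vanishes at \<open>m\<close> and has modulus 1 on the whole boundary.\<close>
definition half_disc_factor :: "real \<Rightarrow> real \<Rightarrow> complex \<Rightarrow> complex" where
  "half_disc_factor R m w =
     (w - of_real m) / (w + of_real m) * ((of_real (R\<^sup>2) + w * of_real m) / (of_real (R\<^sup>2) - w * of_real m))"

lemma open_half_disc: "open (half_disc R)"
proof -
  have "half_disc R = {w. 0 < Re w} \<inter> ball 0 R"
    by (auto simp: half_disc_def)
  thus ?thesis
    by (simp add: open_Int open_halfspace_Re_gt)
qed

lemma closed_closed_half_disc: "closed (closed_half_disc R)"
proof -
  have "closed_half_disc R = {w. 0 \<le> Re w} \<inter> cball 0 R"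
    by (auto simp: closed_half_disc_def)
  thus ?thesis
    by (simp add: closed_Int closed_halfspace_Re_ge)
qed

lemma half_disc_subset: "half_disc R \<subseteq> closed_half_disc R"
  by (auto simp: half_disc_def closed_half_disc_def)

lemma maximum_modulus_half_disc:
  assumes hol: "f holomorphic_on half_disc R" and cont: "continuous_on (closed_half_disc R) f"
    and bd: "\<And>w. w \<in> closed_half_disc R \<Longrightarrow> Re w = 0 \<or> cmod w = R \<Longrightarrow> cmod (f w) \<le> B"
    and x: "x \<in> half_disc R"
  shows "cmod (f x) \<le> B"
proof (rule maximum_modulus_frontier[where S = "half_disc R" and f = f and \<xi> = x])
  have cl: "closure (half_disc R) \<subseteq> closed_half_disc R"
    by (rule closure_minimal[OF half_disc_subset closed_closed_half_disc])
  show "f holomorphic_on interior (half_disc R)"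
    using hol interior_subset holomorphic_on_subset by blast
  show "continuous_on (closure (half_disc R)) f"
    using cont cl continuous_on_subset by blast
  have "half_disc R \<subseteq> ball 0 R"
    by (auto simp: half_disc_def)
  thus "bounded (half_disc R)"
    using bounded_ball bounded_subset by blast
  show "cmod (f z) \<le> B" if "z \<in> frontier (half_disc R)" for z
  proof -
    have "z \<in> closed_half_disc R - half_disc R"
      using that cl interior_open[OF open_half_disc] unfolding frontier_def by blast
    thus ?thesis
      by (intro bd) (auto simp: half_disc_def closed_half_disc_def)
  qed
qed (rule x)

lemma half_disc_factor_nonzero:
  assumes "0 < m" "m < R" "w \<in> closed_half_disc R"
  shows "w + of_real m \<noteq> 0" "of_real (R\<^sup>2) + w * of_real m \<noteq> 0" "of_real (R\<^sup>2) - w * of_real m \<noteq> 0"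
proof -
  have "Re (w + of_real m) > 0"
    using assms by (auto simp: closed_half_disc_def)
  thus "w + of_real m \<noteq> 0"
    by force
  have "cmod (w * of_real m) < cmod (of_real (R\<^sup>2))"
  proof -
    have "cmod (w * of_real m) \<le> R * m"
      using assms by (simp add: norm_mult closed_half_disc_def)
    also have "\<dots> < R * R"
      using assms by simp
    finally show ?thesis
      by (simp add: norm_power power2_eq_square norm_mult)
  qed
  thus "of_real (R\<^sup>2) + w * of_real m \<noteq> 0" "of_real (R\<^sup>2) - w * of_real m \<noteq> 0"
    by (metis add.commute add_eq_0_iff less_irrefl norm_minus_cancel, force)
qed

text \<open>On the imaginary axis conjugation exchanges numerator and denominator of each quotient,
  up to sign. On the arc, R^2 = w * cnj w turns the second quotient into cnj (w + m) / cnj (w - m),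
  whose modulus is the reciprocal of that of the first.\<close>

lemma half_disc_factor_boundary:
  assumes "0 < m" "m < R" "w \<in> closed_half_disc R" "Re w = 0 \<or> cmod w = R"
  shows "cmod (half_disc_factor R m w) = 1"
proof -
  note nz = half_disc_factor_nonzero[OF assms(1,2,3)]
  have "cmod ((w - of_real m) * (of_real (R\<^sup>2) + w * of_real m)) =
        cmod ((w + of_real m) * (of_real (R\<^sup>2) - w * of_real m))"
  proof (cases "Re w = 0")
    case True
    hence *: "w - of_real m = - cnj (w + of_real m)"
             "of_real (R\<^sup>2) + w * of_real m = cnj (of_real (R\<^sup>2) - w * of_real m)"
      by (auto simp: complex_eq_iff)
    show ?thesis
      unfolding * norm_mult norm_minus_cancel complex_mod_cnj by simp
  next
    case False
    hence wR: "w * cnj w = of_real (R\<^sup>2)"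
      using assms(4) complex_norm_square by metis
    have *: "of_real (R\<^sup>2) + w * of_real m = w * cnj (w + of_real m)"
            "of_real (R\<^sup>2) - w * of_real m = w * cnj (w - of_real m)"
      unfolding wR[symmetric] by (simp_all add: algebra_simps)
    show ?thesis
      unfolding * norm_mult complex_mod_cnj by simp
  qed
  thus ?thesis
    using nz unfolding half_disc_factor_def times_divide_times_eq norm_divide by simp
qed

text \<open>Induction on the zeros: dividing \<open>f\<close> by one factor removes one zero, and
  since the factor is unimodular on the boundary the quotient satisfies the same boundary bound
  \<open>B\<close>.\<close>

lemma Blaschke_bound_half_disc:
  assumes "finite A" "A \<subseteq> {0<..<R}"
    and "f holomorphic_on half_disc R" "continuous_on (closed_half_disc R) f"
    and "\<And>w. w \<in> closed_half_disc R \<Longrightarrow> Re w = 0 \<or> cmod w = R \<Longrightarrow> cmod (f w) \<le> B"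
    and "\<And>m. m \<in> A \<Longrightarrow> f (of_real m) = 0"
    and x: "x \<in> half_disc R"
  shows "cmod (f x) \<le> B * (\<Prod>m\<in>A. cmod (half_disc_factor R m x))"
  using assms(1-6)
proof (induction A arbitrary: f rule: finite_induct)
  case empty
  thus ?case
    using maximum_modulus_half_disc[OF _ _ _ x] by simp
next
  case (insert m A)
  have m: "0 < m" "m < R"
    using insert.prems by auto
  note nz = half_disc_factor_nonzero[OF m]
  \<comment> \<open>\<open>g\<close> is the divided difference of \<open>f\<close> at
    \<open>m\<close>, with the removable value filled in. \<open>h\<close> is \<open>f\<close>
    divided by the factor of \<open>m\<close>, with the zero of the denominator absorbed into
    \<open>g\<close>.\<close>
  define g where "g = (\<lambda>w. if w = of_real m then deriv f (of_real m) else (f w - f (of_real m)) / (w - of_real m))"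
  define h where "h = (\<lambda>w. g w * (w + of_real m) * (of_real (R\<^sup>2) - w * of_real m) / (of_real (R\<^sup>2) + w * of_real m))"
  have m0: "f (of_real m) = 0"
    using insert.prems by auto
  have mD: "of_real m \<in> half_disc R"
    using m by (simp add: half_disc_def)
  have ghol: "g holomorphic_on half_disc R"
    unfolding g_def by (rule pole_lemma_open[OF insert.prems(2) open_half_disc])
  \<comment> \<open>Two relatively open pieces: away from \<open>m\<close> the quotient is
    continuous up to the boundary, and in the open half disc, which contains \<open>m\<close>,
    \<open>g\<close> is holomorphic.\<close>
  have gcont: "continuous_on (closed_half_disc R) g"
  proof -
    have "continuous_on (closed_half_disc R - {of_real m}) g"
    proof (rule continuous_on_eq)
      show "continuous_on (closed_half_disc R - {of_real m}) (\<lambda>w. (f w - f (of_real m)) / (w - of_real m))"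
        using insert.prems(3) by (intro continuous_intros continuous_on_subset[OF insert.prems(3)]) auto
    qed (auto simp: g_def)
    hence 1: "continuous_on (closed_half_disc R \<inter> - {of_real m}) g"
      by (simp add: Diff_eq)
    have 2: "continuous_on (closed_half_disc R \<inter> half_disc R) g"
      using holomorphic_on_imp_continuous_on[OF ghol] continuous_on_subset by blast
    have "continuous_on (closed_half_disc R \<inter> - {of_real m} \<union> closed_half_disc R \<inter> half_disc R) g"
    proof (rule continuous_on_Un_local_open[OF _ _ 1 2])
      have *: "closed_half_disc R \<inter> - {of_real m} \<union> closed_half_disc R \<inter> half_disc R = closed_half_disc R"
        using mD by auto
      show "openin (top_of_set (closed_half_disc R \<inter> - {of_real m} \<union> closed_half_disc R \<inter> half_disc R)) (closed_half_disc R \<inter> - {of_real m})"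
        unfolding * by (intro openin_open_Int open_Compl) auto
      show "openin (top_of_set (closed_half_disc R \<inter> - {of_real m} \<union> closed_half_disc R \<inter> half_disc R)) (closed_half_disc R \<inter> half_disc R)"
        unfolding * by (intro openin_open_Int open_half_disc)
    qed
    moreover have "closed_half_disc R \<inter> - {of_real m} \<union> closed_half_disc R \<inter> half_disc R = closed_half_disc R"
      using mD by auto
    ultimately show ?thesis
      by simp
  qed
  have fac: "f w = h w * half_disc_factor R m w" if "w \<in> closed_half_disc R" for w
    using nz[OF that] m0 by (auto simp: h_def half_disc_factor_def g_def)
  have "cmod (h x) \<le> B * (\<Prod>m\<in>A. cmod (half_disc_factor R m x))"
  proof (rule insert.IH)
    show "A \<subseteq> {0<..<R}"
      using insert.prems by auto
    show "h holomorphic_on half_disc R"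
      unfolding h_def using nz half_disc_subset by (intro holomorphic_intros ghol) blast
    show "continuous_on (closed_half_disc R) h"
      unfolding h_def using nz by (intro continuous_intros gcont) blast
    show "cmod (h w) \<le> B" if "w \<in> closed_half_disc R" "Re w = 0 \<or> cmod w = R" for w
      using insert.prems(4)[OF that] half_disc_factor_boundary[OF m that] fac[OF that(1)]
      by (simp add: norm_mult)
    show "h (of_real n) = 0" if "n \<in> A" for n
    proof -
      have "n \<noteq> m" "f (of_real n) = 0"
        using that insert by auto
      thus ?thesis
        by (simp add: h_def g_def m0)
    qed
  qed
  thus ?case
    using fac[of x] half_disc_subset x insert.hyps
    by (simp add: norm_mult subset_iff mult.assoc[symmetric] mult.commute[of "cmod (half_disc_factor R m x)"] mult_right_mono)
qed

text \<open>The term - 2 x / m is the gain from the zero: (1 - u) / (1 + u) is at most exp (- 2 u)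
  for u = x / m. The other term is the loss from reflecting in the arc: (1 + s) / (1 - s) is at most
  exp (3 s) for s = x m / R^2 at most 1/2. The gains sum to a logarithm of \<open>R\<close>, while
  about \<open>R\<close> losses of order 1 / R stay bounded.\<close>

lemma half_disc_factor_le:
  assumes "0 < x" "x < m" "m < R" "2 * x \<le> R"
  shows "cmod (half_disc_factor R m (of_real x)) \<le> exp (- 2 * x / m + 3 * x * m / R\<^sup>2)"
proof -
  have m: "0 < m" "0 < R" using assms by auto
  define s where "s = x * m / R\<^sup>2"
  have s: "0 \<le> s" "s \<le> 1/2"
  proof -
    have "x * m * 2 \<le> R * R"
      using mult_mono[of "2*x" R m R] assms by (simp add: mult_ac)
    thus "s \<le> 1/2" using m by (simp add: s_def power2_eq_square field_simps)
  qed (use assms m in \<open>simp add: s_def\<close>)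
  have eq: "half_disc_factor R m (of_real x) = of_real ((x - m) / (x + m) * ((R\<^sup>2 + x * m) / (R\<^sup>2 - x * m)))"
    unfolding half_disc_factor_def by (simp only: of_real_mult of_real_divide of_real_diff of_real_add of_real_power)
  have 1: "\<bar>(x - m) / (x + m)\<bar> \<le> exp (- 2 * x / m)"
  proof -
    define u where "u = x / m"
    have u: "0 < u" "u < 1" using assms m by (auto simp: u_def)
    have "x = u * m"
      using m by (simp add: u_def)
    hence "(x - m) / (x + m) = (m * (u - 1)) / (m * (u + 1))"
      by (simp add: algebra_simps)
    also have "\<dots> = - ((1 - u) / (1 + u))"
      using m by (simp add: minus_divide_left)
    finally have "\<bar>(x - m) / (x + m)\<bar> = (1 - u) / (1 + u)"
      using u by simp
    moreover have "(1 - u) / (1 + u) \<le> exp (- 2 * u)"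
    proof -
      have "(\<lambda>u. (1 + u) * exp (- 2 * u) - (1 - u)) 0 \<le> (\<lambda>u. (1 + u) * exp (- 2 * u) - (1 - u)) u"
      proof (rule DERIV_nonneg_imp_nondecreasing[OF less_imp_le[OF u(1)]])
        fix y :: real assume y: "0 \<le> y" "y \<le> u"
        have "((\<lambda>u. (1 + u) * exp (- 2 * u) - (1 - u)) has_real_derivative
                 (exp (- 2 * y) + (1 + y) * (exp (-2*y) * (-2)) + 1)) (at y)"
          by (auto intro!: derivative_eq_intros)
        moreover have "exp (- 2 * y) + (1 + y) * (exp (-2*y) * (-2)) + 1 = 1 - (1 + 2 * y) * exp (- 2 * y)"
          by (simp add: algebra_simps)
        moreover have "(1 + 2 * y) * exp (- 2 * y) \<le> exp (2*y) * exp (- 2 * y)"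
          by (intro mult_right_mono exp_ge_add_one_self) auto
        ultimately show "\<exists>z. ((\<lambda>u. (1 + u) * exp (- 2 * u) - (1 - u)) has_real_derivative z) (at y) \<and> 0 \<le> z"
          by (auto simp: exp_minus)
      qed
      thus ?thesis
        using u by (simp add: field_simps)
    qed
    ultimately show ?thesis
      by (simp add: u_def)
  qed
  have 2: "\<bar>(R\<^sup>2 + x * m) / (R\<^sup>2 - x * m)\<bar> \<le> exp (3 * x * m / R\<^sup>2)"
  proof -
    have "(R\<^sup>2 + x * m) / (R\<^sup>2 - x * m) = (1 + s) / (1 - s)"
    proof -
      have "x * m = s * R\<^sup>2" using m by (simp add: s_def)
      hence "(R\<^sup>2 + x * m) / (R\<^sup>2 - x * m) = (R\<^sup>2 * (1 + s)) / (R\<^sup>2 * (1 - s))"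
        by (simp add: algebra_simps)
      thus ?thesis using m by simp
    qed
    moreover have "1 + s \<le> exp s" by (rule exp_ge_add_one_self)
    moreover have "1 / (1 - s) \<le> exp (2 * s)"
    proof -
      \<comment> \<open>The right-hand side is 1 + s (1 - 2 s); this is where s at most 1/2, hence 2
        x at most \<open>R\<close>, enters.\<close>
      have "1 \<le> (1 + 2 * s) * (1 - s)"
        using s mult_left_mono[of s "1/2" s] by (simp add: algebra_simps)
      also have "\<dots> \<le> exp (2 * s) * (1 - s)"
        using s by (intro mult_right_mono exp_ge_add_one_self) auto
      finally show ?thesis using s by (simp add: field_simps)
    qed
    ultimately have "\<bar>(R\<^sup>2 + x * m) / (R\<^sup>2 - x * m)\<bar> \<le> exp s * exp (2 * s)"
      using s mult_mono[of "1 + s" "exp s" "1 / (1 - s)" "exp (2 * s)"] by simp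
    thus ?thesis
      by (simp add: s_def exp_add[symmetric] mult_ac)
  qed
  show ?thesis
    unfolding eq norm_of_real abs_mult exp_add by (intro mult_mono 1 2) auto
qed

text \<open>On the half plane \<open>\<bar>exp (2 w Ln (w + 1))\<bar>\<close> compensates the growth \<open>exp (pi \<bar>w\<bar>)\<close> up to a factor
  \<open>exp (O(Re w))\<close>; the shift by 1 avoids the singularity of \<open>Ln\<close> at 0.\<close>
lemma Im_Ln_bound:
  assumes "0 \<le> Re w"
  shows "pi * cmod w - 2 * Im w * Im (Ln (w + 1)) \<le> (pi + 2) * Re w + 2"
proof -
  define p where "p = Re w + 1"
  have p: "p > 0" using assms by (simp add: p_def)
  have Arg: "Im (Ln (w + 1)) = arctan (Im w / p)"
    using assms by (subst Im_Ln_eq) (auto simp: p_def complex_eq_iff)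
  have key: "pi / 2 * y - p \<le> y * arctan (y / p)" if "y > 0" for y
  proof -
    have "arctan (inverse (p / y)) = pi / 2 - arctan (p / y)"
      using that p by (intro arctan_inverse[THEN trans]) auto
    hence "arctan (y / p) = pi / 2 - arctan (p / y)"
      by simp
    hence "y * arctan (y / p) = pi / 2 * y - y * arctan (p / y)"
      by (simp only: right_diff_distrib mult.commute)
    moreover have "y * arctan (p / y) \<le> y * (p / y)"
      using that p by (intro mult_left_mono arctan_le_self) auto
    ultimately show ?thesis using that by simp
  qed
  have "pi / 2 * \<bar>Im w\<bar> - p \<le> Im w * arctan (Im w / p)"
  proof (cases "Im w = 0")
    case False
    have "Im w * arctan (Im w / p) = \<bar>Im w\<bar> * arctan (\<bar>Im w\<bar> / p)"
      by (cases "Im w > 0") (auto simp: arctan_minus)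
    thus ?thesis
      using key[of "\<bar>Im w\<bar>"] False by simp
  qed (use p in auto)
  moreover have "pi * cmod w \<le> pi * (\<bar>Re w\<bar> + \<bar>Im w\<bar>)"
    by (intro mult_left_mono cmod_le) auto
  ultimately show ?thesis
    using assms unfolding Arg by (simp add: p_def algebra_simps)
qed

text \<open>The product of the Blaschke factors decays like a power of the radius that beats the
  growth of type pi as soon as the density of zeros exceeds 1. The point \<open>x\<close> is taken
  below all zeros, where each factor has a simple explicit bound; an interval of zeros is all that
  the identity theorem asks for later.\<close>

lemma Carlson_zero_density:
  fixes mu :: "nat \<Rightarrow> real" and H :: "complex \<Rightarrow> complex"
  assumes hol: "H holomorphic_on {w. 0 < Re w}" and cont: "continuous_on {w. 0 \<le> Re w} H"
    and bd: "\<And>w. 0 \<le> Re w \<Longrightarrow> cmod (H w) \<le> C * exp (pi * cmod w)"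
    and incr: "strict_mono_on {1..} mu" and pos: "\<And>n. n \<ge> 1 \<Longrightarrow> mu n > 0"
    and lim: "(\<lambda>n. mu n / real n) \<longlonglongrightarrow> \<alpha>" and "\<alpha> < 1"
    and zero: "\<And>n. n \<ge> 1 \<Longrightarrow> H (of_real (mu n)) = 0"
    and x: "0 < x" "x < mu 1"
  shows "H (of_real x) = 0"
proof -
  \<comment> \<open>A number strictly between the limit and 1; the maximum with 0 makes it positive,
    so that 1 / q bounds the density of zeros from below.\<close>
  define q where "q = (max \<alpha> 0 + 1) / 2"
  have q: "\<alpha> < q" "0 < q" "q < 1"
    using \<open>\<alpha> < 1\<close> by (auto simp: q_def)
  have C: "C \<ge> 0"
    using order_trans[OF norm_ge_zero bd[of 0]] by simp
  have "eventually (\<lambda>n. mu n / real n < q) sequentially"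
    using lim q(1) by (rule order_tendstoD)
  then obtain n1 where n1: "\<And>n. n \<ge> n1 \<Longrightarrow> mu n / real n < q"
    by (auto simp: eventually_sequentially)
  define n0 where "n0 = max n1 1"
  have n0: "1 \<le> n0" "\<And>n. n \<ge> n0 \<Longrightarrow> mu n \<le> q * real n"
  proof -
    show "mu n \<le> q * real n" if "n \<ge> n0" for n
      using n1[of n] that by (simp add: n0_def pos_divide_less_eq)
  qed (simp add: n0_def)
  \<comment> \<open>Everything independent of \<open>N\<close>: the boundary bound of
    \<open>f\<close>, the total loss 3 x, the harmonic sum over the indices below \<open>n0\<close>,
    where no zero is used, and the cost at \<open>x\<close> of undoing the exponential factor in
    \<open>f\<close>.\<close>
  define K where "K = C * exp 4 * exp (3 * x + 2 * x / q * harm (n0 - 1) - 2 * x * ln (x + 1) + (pi + 2) * x)"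
  have main: "cmod (H (of_real x)) \<le> K * exp (2 * x * (1 - 1 / q) * ln (real N))"
    if N: "N \<ge> n0" "real N \<ge> 2 * x" for N
  proof -
    \<comment> \<open>Radius and number of zeros are tied together: \<open>mu n\<close> is at most q
      n < \<open>R\<close> for every index from \<open>n0\<close> to \<open>N\<close>, so all these
      zeros lie in the half disc.\<close>
    define R where "R = real N"
    have R: "R \<ge> 1" "2 * x \<le> R" "x < R"
      using N n0 x by (auto simp: R_def)
    \<comment> \<open>\<open>f\<close> is bounded on the half disc independently of \<open>R\<close>, at the price of a factor of order \<open>R powr (- 2 * x)\<close>
      at \<open>x\<close>; the zeros gain \<open>R powr (- 2 * x / q)\<close>, which wins as \<open>q < 1\<close>.\<close>
    define f where "f = (\<lambda>w. H w * exp (2 * w * (Ln (w + 1) - of_real (ln R)) - of_real (pi + 2) * w))"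
    have mu_bounds: "x < mu n" "mu n < R" if "n \<in> {n0..N}" for n
    proof -
      have "mu 1 \<le> mu n"
        using strict_mono_onD[OF incr, of 1 n] that n0 by (cases "n = 1") auto
      thus "x < mu n" using x by simp
      have "mu n \<le> q * real n" using n0(2)[of n] that by simp
      also have "\<dots> \<le> q * R" using that q by (simp add: R_def)
      also have "\<dots> < 1 * R" using q R by (intro mult_strict_right_mono) auto
      finally show "mu n < R" by simp
    qed
    have inj: "inj_on mu {n0..N}"
      using strict_mono_on_imp_inj_on[OF incr] n0 by (auto intro: inj_on_subset)
    have "cmod (f (of_real x)) \<le> C * exp 4 * (\<Prod>m\<in>mu ` {n0..N}. cmod (half_disc_factor R m (of_real x)))"
    proof (rule Blaschke_bound_half_disc)
      show "mu ` {n0..N} \<subseteq> {0<..<R}"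
        using mu_bounds x by force
      have nz: "w + 1 \<notin> \<real>\<^sub>\<le>\<^sub>0" if "0 \<le> Re w" for w
        using that by (auto simp: complex_nonpos_Reals_iff)
      show "f holomorphic_on half_disc R"
        unfolding f_def using nz by (intro holomorphic_intros holomorphic_on_subset[OF hol]) (auto simp: half_disc_def)
      show "continuous_on (closed_half_disc R) f"
        unfolding f_def using nz by (intro continuous_intros continuous_on_subset[OF cont]) (auto simp: closed_half_disc_def)
      show "f (of_real m) = 0" if "m \<in> mu ` {n0..N}" for m
        using that zero n0 by (auto simp: f_def)
      show "of_real x \<in> half_disc R"
        using x R by (simp add: half_disc_def)
      show "cmod (f w) \<le> C * exp 4" if w: "w \<in> closed_half_disc R" for w
      proof -
        have w0: "0 \<le> Re w" "cmod w \<le> R" using w by (auto simp: closed_half_disc_def)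
        hence w1: "w + 1 \<noteq> 0" by (auto simp: complex_eq_iff)
        have "Re w * (ln (cmod (w + 1)) - ln R) \<le> 1"
        proof -
          have "cmod (w + 1) \<le> R + 1"
            using norm_triangle_ineq[of w 1] w0 by simp
          hence "ln (cmod (w + 1)) - ln R \<le> ln (R + 1) - ln R"
            using w1 R by simp
          also have "\<dots> = ln (1 + 1 / R)"
            using R ln_divide_pos[of "R + 1" R] by (simp add: add_divide_distrib)
          also have "\<dots> \<le> 1 / R"
            using R by (intro ln_add_one_self_le_self) auto
          finally have "Re w * (ln (cmod (w + 1)) - ln R) \<le> Re w * (1 / R)"
            using w0 by (intro mult_left_mono) auto
          also have "\<dots> \<le> 1"
            using R w0 complex_Re_le_cmod[of w] by (simp add: field_simps)
          finally show ?thesis .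
        qed
        moreover have "Re (2 * w * (Ln (w + 1) - of_real (ln R)) - of_real (pi + 2) * w) =
              2 * (Re w * (ln (cmod (w + 1)) - ln R)) - 2 * Im w * Im (Ln (w + 1)) - (pi + 2) * Re w"
          using w1 by (simp add: algebra_simps)
        \<comment> \<open>The 4 is the constant 2 of \<open>Im_Ln_bound\<close> plus twice the bound
          1 just shown; the terms in \<open>Re w\<close> cancel.\<close>
        ultimately have "pi * cmod w + Re (2 * w * (Ln (w + 1) - of_real (ln R)) - of_real (pi + 2) * w) \<le> 4"
          using Im_Ln_bound[OF w0(1)] by linarith
        moreover have "cmod (f w) \<le> C * exp (pi * cmod w) *
            exp (Re (2 * w * (Ln (w + 1) - of_real (ln R)) - of_real (pi + 2) * w))"
          unfolding f_def norm_mult norm_exp_eq_Re by (intro mult_right_mono bd w0) auto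
        ultimately show ?thesis
          using C by (smt (verit) exp_add exp_le_cancel_iff mult.assoc mult_left_mono)
      qed
    qed auto
    also have "(\<Prod>m\<in>mu ` {n0..N}. cmod (half_disc_factor R m (of_real x))) =
               (\<Prod>n\<in>{n0..N}. cmod (half_disc_factor R (mu n) (of_real x)))"
      using inj by (simp add: prod.reindex)
    also have "\<dots> \<le> (\<Prod>n\<in>{n0..N}. exp (- (2 * x / q) * (1 / real n) + 3 * x / R))"
    proof (intro prod_mono conjI norm_ge_zero)
      fix n assume n: "n \<in> {n0..N}"
      note b = mu_bounds[OF n]
      have "cmod (half_disc_factor R (mu n) (of_real x)) \<le> exp (- 2 * x / mu n + 3 * x * mu n / R\<^sup>2)"
        using b x R by (intro half_disc_factor_le) auto
      also have "\<dots> \<le> exp (- (2 * x / q) * (1 / real n) + 3 * x / R)"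
      proof -
        have "2 * x / (q * real n) \<le> 2 * x / mu n"
          using n0 n x b q by (intro divide_left_mono mult_pos_pos n0(2)) auto
        moreover have "3 * x * mu n / R\<^sup>2 \<le> 3 * x * R / R\<^sup>2"
          using b x R by (intro divide_right_mono mult_left_mono) auto
        moreover have "3 * x * R / R\<^sup>2 = 3 * x / R"
          using R by (simp add: power2_eq_square)
        ultimately show ?thesis by simp
      qed
      finally show "cmod (half_disc_factor R (mu n) (of_real x)) \<le> exp (- (2 * x / q) * (1 / real n) + 3 * x / R)" .
    qed
    also have "\<dots> = exp (\<Sum>n\<in>{n0..N}. - (2 * x / q) * (1 / real n) + 3 * x / R)"
      by (simp add: exp_sum)
    also have "\<dots> \<le> exp (- (2 * x / q) * (ln R - harm (n0 - 1)) + 3 * x)"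
    proof -
      have "(\<Sum>n\<in>{n0..N}. 1 / real n) = harm N - harm (n0 - 1)"
      proof -
        have "{1..N} = {1..n0 - 1} \<union> {n0..N}" using n0(1) N by auto
        hence "harm N = (\<Sum>n\<in>{1..n0 - 1} \<union> {n0..N}. 1 / real n)"
          by (simp add: harm_def divide_inverse)
        also have "\<dots> = harm (n0 - 1) + (\<Sum>n\<in>{n0..N}. 1 / real n)"
          using n0(1) by (subst sum.union_disjoint) (auto simp: harm_def divide_inverse)
        finally show ?thesis by simp
      qed
      moreover have "ln R \<le> harm N"
      proof -
        have "ln R \<le> ln (real N + 1)" using R by (simp add: R_def)
        also have "\<dots> \<le> harm N" by (rule ln_le_harm)
        finally show ?thesis .
      qed
      ultimately have "(2 * x / q) * (ln R - harm (n0 - 1)) \<le> (2 * x / q) * (\<Sum>n\<in>{n0..N}. 1 / real n)"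
        using x q by (intro mult_left_mono) auto
      moreover have "(\<Sum>n\<in>{n0..N}. 3 * x / R) \<le> 3 * x"
      proof -
        have "real (card {n0..N}) * (3 * x / R) \<le> R * (3 * x / R)"
          using x R n0(1) by (intro mult_right_mono) (auto simp: R_def)
        thus ?thesis using R by simp
      qed
      ultimately show ?thesis
        by (simp only: sum.distrib sum_distrib_left[symmetric] exp_le_cancel_iff)
    qed
    finally have fin: "cmod (f (of_real x)) \<le> C * exp 4 * exp (- (2 * x / q) * (ln R - harm (n0 - 1)) + 3 * x)"
      using C by (simp add: mult_left_mono)
    have "Ln (of_real x + 1) = of_real (ln (x + 1))"
      using x Ln_of_real[of "x + 1"] by simp
    hence "f (of_real x) = H (of_real x) * of_real (exp (2 * x * (ln (x + 1) - ln R) - (pi + 2) * x))"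
      unfolding f_def by (simp flip: exp_of_real)
    hence "cmod (H (of_real x)) = cmod (f (of_real x)) * exp (- (2 * x * (ln (x + 1) - ln R) - (pi + 2) * x))"
      by (simp add: norm_mult mult_exp_exp)
    also have "\<dots> \<le> C * exp 4 * exp (- (2 * x / q) * (ln R - harm (n0 - 1)) + 3 * x)
                    * exp (- (2 * x * (ln (x + 1) - ln R) - (pi + 2) * x))"
      by (intro mult_right_mono fin) auto
    also have "\<dots> = K * exp (2 * x * (1 - 1 / q) * ln R)"
      unfolding K_def mult.assoc exp_add[symmetric] using q by (simp add: algebra_simps)
    finally show ?thesis by (simp add: R_def)
  qed
  have "(\<lambda>N. K * exp (2 * x * (1 - 1 / q) * ln (real N))) \<longlonglongrightarrow> K * 0"
  proof (intro tendsto_mult tendsto_const filterlim_compose[OF exp_at_bot])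
    have "filterlim (\<lambda>N. ln (real N)) at_top sequentially"
      by (intro filterlim_compose[OF ln_at_top] filterlim_real_sequentially)
    moreover have "2 * x * (1 - 1 / q) < 0"
      using x q by (intro mult_pos_neg) (auto simp: field_simps)
    ultimately show "filterlim (\<lambda>N. 2 * x * (1 - 1 / q) * ln (real N)) at_bot sequentially"
      by (intro filterlim_tendsto_neg_mult_at_bot[OF tendsto_const])
  qed
  moreover have "eventually (\<lambda>N. cmod (H (of_real x)) \<le> K * exp (2 * x * (1 - 1 / q) * ln (real N))) sequentially"
  proof (rule eventually_sequentiallyI)
    fix N assume "max n0 (nat \<lceil>2 * x\<rceil>) \<le> N"
    thus "cmod (H (of_real x)) \<le> K * exp (2 * x * (1 - 1 / q) * ln (real N))"
      by (intro main) linarith+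
  qed
  ultimately have "cmod (H (of_real x)) \<le> K * 0"
    by (intro tendsto_lowerbound) auto
  thus ?thesis by simp
qed

subsection \<open>Entire functions with equal modulus on two lines\<close>

text \<open>\<open>g\<close> vanishes on the nonempty open set where \<open>f\<close> does not,
  hence everywhere.\<close>

lemma holomorphic_zero_product:
  assumes f: "f holomorphic_on UNIV" and g: "g holomorphic_on UNIV"
    and fg: "\<And>z. f z * g z = 0" and z0: "f z0 \<noteq> 0"
  shows "g z = 0"
proof (rule analytic_continuation_open[where s = "{z. f z \<noteq> 0}" and s' = UNIV and f = g and g = "\<lambda>_. 0"])
  show "open {z. f z \<noteq> 0}"
    using f by (intro open_Collect_neq holomorphic_on_imp_continuous_on continuous_on_const)
qed (use fg z0 g in auto)

lemma holomorphic_reflect: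
  assumes "f holomorphic_on UNIV"
  shows "(\<lambda>z. cnj (f (e * cnj z))) holomorphic_on UNIV"
proof -
  have "(\<lambda>z. f (e * z)) holomorphic_on UNIV"
    using holomorphic_on_compose[of "\<lambda>z. e * z" UNIV f] assms
    by (auto simp: o_def intro!: holomorphic_intros intro: holomorphic_on_subset)
  hence "(cnj \<circ> (\<lambda>z. f (e * z)) \<circ> cnj) holomorphic_on UNIV"
    by (intro holomorphic_on_compose_cnj_cnj) (auto intro: holomorphic_on_subset)
  thus ?thesis
    by (simp add: o_def)
qed

text \<open>The map taking z to e^2 * cnj z is the reflection in the line spanned by
  \<open>e\<close>. On that line it fixes z, and the identity says |F1|^2 = |F2|^2; both sides are
  entire in z, so it is the analytic continuation of that equality.\<close>

lemma reflection_identity: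
  fixes lam :: "nat \<Rightarrow> real"
  assumes F: "F1 holomorphic_on UNIV" "F2 holomorphic_on UNIV"
    and bd: "\<And>z. cmod (F1 z) \<le> C * exp (pi / 2 * (cmod z)\<^sup>2)" "\<And>z. cmod (F2 z) \<le> C * exp (pi / 2 * (cmod z)\<^sup>2)"
    and e: "cmod e = 1"
    and incr: "strict_mono_on {1..} lam" and pos: "\<And>n. n \<ge> 1 \<Longrightarrow> lam n > 0"
    and lim: "(\<lambda>n. lam n / sqrt (real n)) \<longlonglongrightarrow> a" and "a < 1"
    and eq: "\<And>n. n \<ge> 1 \<Longrightarrow> cmod (F1 (e * of_real (lam n))) = cmod (F2 (e * of_real (lam n)))"
  shows "F1 z * cnj (F1 (e\<^sup>2 * cnj z)) = F2 z * cnj (F2 (e\<^sup>2 * cnj z))"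
proof -
  \<comment> \<open>The line is rotated to the real axis, where \<open>G\<close> equals |F1|^2 -
    |F2|^2.\<close>
  define G where "G = (\<lambda>w. F1 (e * w) * cnj (F1 (e * cnj w)) - F2 (e * w) * cnj (F2 (e * cnj w)))"
  have comp: "(\<lambda>w. F (e * w)) holomorphic_on UNIV" if "F holomorphic_on UNIV" for F
    using holomorphic_on_compose[of "\<lambda>z. e * z" UNIV F] that
    by (auto simp: o_def intro!: holomorphic_intros intro: holomorphic_on_subset)
  have Ghol: "G holomorphic_on UNIV"
    unfolding G_def by (intro holomorphic_intros comp[OF F(1)] comp[OF F(2)] holomorphic_reflect F)
  have Gbd: "cmod (G w) \<le> 2 * C\<^sup>2 * exp (pi * (cmod w)\<^sup>2)" for w
  proof -
    have *: "cmod (F (e * w) * cnj (F (e * cnj w))) \<le> C\<^sup>2 * exp (pi * (cmod w)\<^sup>2)"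
      if F: "\<And>z. cmod (F z) \<le> C * exp (pi / 2 * (cmod z)\<^sup>2)" for F
    proof -
      have "cmod (F (e * w)) \<le> C * exp (pi / 2 * (cmod w)\<^sup>2)" "cmod (F (e * cnj w)) \<le> C * exp (pi / 2 * (cmod w)\<^sup>2)"
        using F[of "e * w"] F[of "e * cnj w"] e by (simp_all add: norm_mult)
      hence "cmod (F (e * w)) * cmod (F (e * cnj w)) \<le>
            (C * exp (pi / 2 * (cmod w)\<^sup>2)) * (C * exp (pi / 2 * (cmod w)\<^sup>2))"
        by (meson mult_mono norm_ge_zero order_trans)
      also have "\<dots> = C\<^sup>2 * exp (pi * (cmod w)\<^sup>2)"
        by (simp add: power2_eq_square mult_exp_exp)
      finally have "cmod (F (e * w)) * cmod (F (e * cnj w)) \<le> C\<^sup>2 * exp (pi * (cmod w)\<^sup>2)" .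
      thus ?thesis by (simp add: norm_mult)
    qed
    show ?thesis
      using norm_triangle_ineq4[of "F1 (e * w) * cnj (F1 (e * cnj w))" "F2 (e * w) * cnj (F2 (e * cnj w))"]
        *[of F1, OF bd(1)] *[of F2, OF bd(2)] unfolding G_def by simp
  qed
  have "G (of_real x) = 0" if x: "0 < x" "x < lam 1" for x
  proof -
    \<comment> \<open>The square root turns order 2 and type pi into exponential type pi, and zeros
      near a sqrt n into zeros near a^2 n. The principal branch is holomorphic on the open right
      half plane; no evenness of \<open>G\<close> is involved.\<close>
    have "G (csqrt (of_real (x\<^sup>2))) = 0"
    proof (rule Carlson_zero_density[where H = "\<lambda>w. G (csqrt w)" and mu = "\<lambda>n. (lam n)\<^sup>2" and \<alpha> = "a\<^sup>2"])
      have "(G \<circ> csqrt) holomorphic_on {w. 0 < Re w}"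
        by (rule holomorphic_on_compose)
           (auto intro!: holomorphic_intros holomorphic_on_subset[OF Ghol] simp: complex_nonpos_Reals_iff)
      thus "(\<lambda>w. G (csqrt w)) holomorphic_on {w. 0 < Re w}"
        by (simp add: o_def)
      \<comment> \<open>The closed half plane meets the branch cut only at 0, where |csqrt w| = sqrt
        |w| gives continuity.\<close>
      have "continuous_on {w. 0 \<le> Re w} csqrt"
        unfolding continuous_on_eq_continuous_within
      proof
        fix w :: complex assume "w \<in> {w. 0 \<le> Re w}"
        show "continuous (at w within {w. 0 \<le> Re w}) csqrt"
        proof (cases "w = 0")
          case True
          have "((\<lambda>z. sqrt (cmod z)) \<longlongrightarrow> sqrt (cmod 0)) (at 0 within {w. 0 \<le> Re w})"
            by (intro tendsto_intros)
          hence "(csqrt \<longlongrightarrow> 0) (at 0 within {w. 0 \<le> Re w})"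
            by (subst tendsto_norm_zero_iff[symmetric]) simp
          thus ?thesis
            using True by (simp add: continuous_within)
        next
          case False
          thus ?thesis
            using \<open>w \<in> _\<close> by (intro continuous_within_csqrt) (auto simp: complex_nonpos_Reals_iff complex_eq_iff)
        qed
      qed
      thus "continuous_on {w. 0 \<le> Re w} (\<lambda>w. G (csqrt w))"
        by (intro continuous_on_compose2[OF holomorphic_on_imp_continuous_on[OF Ghol]]) auto
      show "cmod (G (csqrt w)) \<le> 2 * C\<^sup>2 * exp (pi * cmod w)" for w
        using Gbd[of "csqrt w"] by (simp flip: norm_power)
      show "strict_mono_on {1..} (\<lambda>n. (lam n)\<^sup>2)"
        using pos by (intro strict_mono_onI power_strict_mono strict_mono_onD[OF incr]) (auto intro: less_imp_le)
      have "(\<lambda>n. (lam n / sqrt (real n))\<^sup>2) \<longlonglongrightarrow> a\<^sup>2"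
        by (intro tendsto_power lim)
      thus "(\<lambda>n. (lam n)\<^sup>2 / real n) \<longlonglongrightarrow> a\<^sup>2"
        by (simp add: power_divide)
      have "0 \<le> a"
        by (rule tendsto_lowerbound[OF lim])
           (auto intro!: eventually_sequentiallyI[of 1] divide_nonneg_nonneg less_imp_le[OF pos])
      thus "a\<^sup>2 < 1"
        using \<open>a < 1\<close> by (simp add: power_less_one_iff abs_square_less_1)
      show "G (csqrt (of_real ((lam n)\<^sup>2))) = 0" if "n \<ge> 1" for n
      proof -
        have "csqrt (of_real ((lam n)\<^sup>2)) = of_real (lam n)"
          using pos[OF that] by (subst csqrt_of_real_nonneg) (auto simp: less_imp_le)
        thus ?thesis
          using eq[OF that] by (simp add: G_def complex_norm_square[symmetric] flip: of_real_power)
      qed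
      show "(lam n)\<^sup>2 > 0" if "n \<ge> 1" for n
        using pos[OF that] by simp
      show "0 < x\<^sup>2" "x\<^sup>2 < (lam 1)\<^sup>2"
        using x by (auto intro: power_strict_mono)
    qed
    moreover have "csqrt (of_real (x\<^sup>2)) = of_real x"
      using x by (subst csqrt_of_real_nonneg) auto
    ultimately show ?thesis by simp
  qed
  hence zero: "G z = 0" if "z \<in> of_real ` {0<..<lam 1}" for z
    using that by auto
  have "lam 1 > 0" using pos by simp
  have lp: "complex_of_real (lam 1 / 2) islimpt of_real ` {0<..<lam 1}"
  proof -
    have "(lam 1 / 2) islimpt {0<..<lam 1}"
      using \<open>lam 1 > 0\<close> by (intro interior_limit_point) (simp add: interior_open)
    thus ?thesis
      by (rule islimpt_isCont_image) (auto simp: eventually_at_filter simp del: of_real_divide)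
  qed
  have "G w = 0" for w
    by (rule analytic_continuation[OF Ghol _ _ _ _ lp zero]) auto
  from this[of "z / e"] have "F1 (e * (z / e)) * cnj (F1 (e * cnj (z / e))) = F2 (e * (z / e)) * cnj (F2 (e * cnj (z / e)))"
    by (simp add: G_def)
  moreover have "e \<noteq> 0" using e by auto
  moreover have "e * cnj (z / e) = e\<^sup>2 * cnj z"
  proof -
    have "e * cnj e = 1"
      using e complex_norm_square[of e] by simp
    hence "cnj (z / e) = e * cnj z"
      using \<open>e \<noteq> 0\<close> by (simp add: field_simps)
    thus ?thesis by (simp add: power2_eq_square)
  qed
  ultimately show ?thesis by simp
qed

text \<open>Zeros are isolated, so a small circle about 0 avoids them. A circle is what is wanted
  because it meets every line through 0 and is preserved by rotations.\<close>

lemma nonvanishing_circle: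
  assumes "F holomorphic_on UNIV" "F b \<noteq> 0"
  shows "\<exists>r>0. \<forall>z. cmod z = r \<longrightarrow> F z \<noteq> 0"
proof (cases "F 0 = 0")
  case True
  then obtain s where s: "0 < s" "\<And>z. z \<in> ball 0 s - {0} \<Longrightarrow> F z \<noteq> 0"
    using isolated_zeros[OF assms(1), of 0 b] assms(2) by auto
  show ?thesis
    by (rule exI[of _ "s / 2"]) (use s in auto)
next
  case False
  have "isCont F 0"
    using assms(1) holomorphic_on_imp_continuous_on continuous_on_eq_continuous_at open_UNIV by blast
  hence "\<forall>\<^sub>F z in at 0. F z \<noteq> 0"
    using False by (intro tendsto_imp_eventually_ne) (auto simp: isCont_def)
  then obtain s where s: "0 < s" "\<And>z. z \<noteq> 0 \<Longrightarrow> dist z 0 < s \<Longrightarrow> F z \<noteq> 0"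
    by (auto simp: eventually_at)
  show ?thesis
    by (rule exI[of _ "s / 2"]) (use s in auto)
qed

text \<open>Two equal powers would make 2 d times a positive integer a multiple of 2 pi, and d / pi
  rational.\<close>

lemma cis_power_inj:
  assumes "d / pi \<notin> \<rat>"
  shows "inj (\<lambda>n::nat. cis (2 * d) ^ n)"
proof (rule linorder_injI)
  fix m n :: nat assume "m < n"
  show "cis (2 * d) ^ m \<noteq> cis (2 * d) ^ n"
  proof
    assume "cis (2 * d) ^ m = cis (2 * d) ^ n"
    hence "cis (2 * d) ^ m * cis (2 * d) ^ (n - m) = cis (2 * d) ^ m * 1"
      using \<open>m < n\<close> by (subst power_add[symmetric]) simp
    hence "cis (2 * d) ^ (n - m) = 1"
      by simp
    moreover have "cis (2 * d * real (n - m)) = cis (2 * d) ^ (n - m)"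
      using Complex.DeMoivre[of "2 * d" "n - m"] by (simp add: mult.commute)
    ultimately have "cis (2 * d * real (n - m)) = 1"
      by (rule trans[rotated])
    then obtain k :: int where "2 * d * real (n - m) = of_int k * (2 * pi)"
      using cos_one_2pi_int[of "2 * d * real (n - m)"] by (auto simp: complex_eq_iff)
    hence "d / pi = of_int k / of_nat (n - m)"
      using \<open>m < n\<close> by (simp add: field_simps)
    thus False
      using assms by (metis Rats_divide Rats_of_int Rats_of_nat)
  qed
qed

text \<open>The two reflections compose to a rotation by 2 d. Multiplying one identity by the other
  crosswise eliminates the values of one reflection against those of the other; working with
  products instead of F1 / F2 avoids poles.\<close>

lemma entire_proportional:
  assumes F: "F1 holomorphic_on UNIV" "F2 holomorphic_on UNIV"
    and e: "cmod e1 = 1" "e2 = e1 * cis d" and d: "d / pi \<notin> \<rat>"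
    and r1: "\<And>z. F1 z * cnj (F1 (e1\<^sup>2 * cnj z)) = F2 z * cnj (F2 (e1\<^sup>2 * cnj z))"
    and r2: "\<And>z. F1 z * cnj (F1 (e2\<^sup>2 * cnj z)) = F2 z * cnj (F2 (e2\<^sup>2 * cnj z))"
  shows "\<exists>c. cmod c = 1 \<and> (\<forall>z. F1 z = c * F2 z)"
proof -
  have refl: "e1\<^sup>2 * cnj (e1 * of_real r) = e1 * of_real r" for r
    using e(1) complex_norm_square[of e1] by (simp add: power2_eq_square algebra_simps)
  have norm_eq: "cmod (F1 (e1 * of_real r)) = cmod (F2 (e1 * of_real r))" for r
  proof -
    have "(cmod (F1 (e1 * of_real r)))\<^sup>2 = (cmod (F2 (e1 * of_real r)))\<^sup>2"
      using r1[of "e1 * of_real r"] unfolding refl complex_norm_square[symmetric] of_real_eq_iff .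
    thus ?thesis by simp
  qed
  \<comment> \<open>An entire function that is not identically zero has a zero-free circle about 0,
    which meets the line. This settles the case that one of \<open>F1\<close>, \<open>F2\<close> is
    zero.\<close>
  have vanish: "F z = 0" if Fh: "F holomorphic_on UNIV" and Fz: "\<And>r. F (e1 * of_real r) = 0" for F z
  proof (rule ccontr)
    assume "F z \<noteq> 0"
    then obtain r where r: "r > 0" "\<And>z. cmod z = r \<Longrightarrow> F z \<noteq> 0"
      using nonvanishing_circle[OF Fh] by blast
    thus False
      using Fz[of r] e(1) by (simp add: norm_mult)
  qed
  show ?thesis
  proof (cases "\<forall>z. F2 z = 0")
    case True
    have "F1 z = 0" for z
      by (rule vanish[OF F(1)]) (use norm_eq True in simp)
    thus ?thesis
      using True by (intro exI[of _ 1]) auto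
  next
    case False
    then obtain b2 where b2: "F2 b2 \<noteq> 0" by auto
    obtain b1 where b1: "F1 b1 \<noteq> 0"
    proof (rule ccontr)
      assume "\<not> thesis"
      hence "F1 z = 0" for z using that by blast
      hence "F2 (e1 * of_real r) = 0" for r using norm_eq[of r] by simp
      thus False using vanish[OF F(2)] b2 by blast
    qed
    define \<rho> where "\<rho> = cis (2 * d)"
    have e2: "e2\<^sup>2 = \<rho> * e1\<^sup>2"
      by (simp add: e(2) \<rho>_def power2_eq_square cis_mult mult_ac)
    \<comment> \<open>\<open>D\<close> = 0 is the cross-multiplied invariance of F1 / F2 under the
      rotation. \<open>D'\<close> is its reflection in the first line, the form in which the two
      identities can be substituted.\<close>
    define D where "D = (\<lambda>u. F1 u * F2 (\<rho> * u) - F2 u * F1 (\<rho> * u))"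
    define D' where "D' = (\<lambda>z. cnj (D (e1\<^sup>2 * cnj z)))"
    have comp: "(\<lambda>w. F (\<rho> * w)) holomorphic_on UNIV" if "F holomorphic_on UNIV" for F
      using holomorphic_on_compose[of "\<lambda>z. \<rho> * z" UNIV F] that
      by (auto simp: o_def intro!: holomorphic_intros intro: holomorphic_on_subset)
    have "D holomorphic_on UNIV"
      unfolding D_def by (intro holomorphic_intros comp[OF F(1)] comp[OF F(2)] F)
    hence D'hol: "D' holomorphic_on UNIV"
      unfolding D'_def by (rule holomorphic_reflect)
    have prod: "F1 z * (F2 z * D' z) = 0" for z
    proof -
      have "F1 z * (F2 z * D' z) =
          (F1 z * cnj (F1 (e1\<^sup>2 * cnj z))) * (F2 z * cnj (F2 (e2\<^sup>2 * cnj z))) -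
          (F2 z * cnj (F2 (e1\<^sup>2 * cnj z))) * (F1 z * cnj (F1 (e2\<^sup>2 * cnj z)))"
        unfolding D'_def D_def e2 by (simp add: algebra_simps)
      thus ?thesis unfolding r1 r2 by simp
    qed
    have "F2 z * D' z = 0" for z
      by (rule holomorphic_zero_product[OF F(1) _ prod b1]) (intro holomorphic_intros F D'hol)
    hence "D' z = 0" for z
      by (rule holomorphic_zero_product[OF F(2) D'hol _ b2])
    moreover have "e1\<^sup>2 * cnj (e1\<^sup>2 * cnj u) = u" for u
    proof -
      have "e1 * cnj e1 = 1"
        using e(1) complex_norm_square[of e1] by simp
      moreover have "e1\<^sup>2 * cnj (e1\<^sup>2 * cnj u) = (e1 * cnj e1)\<^sup>2 * u"
        by (simp add: power_mult_distrib)
      ultimately show ?thesis by simp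
    qed
    ultimately have "D u = 0" for u
      unfolding D'_def by (metis complex_cnj_zero_iff)
    hence D: "F1 u * F2 (\<rho> * u) = F2 u * F1 (\<rho> * u)" for u
      unfolding D_def by simp
    obtain r where r: "r > 0" "\<And>z. cmod z = r \<Longrightarrow> F2 z \<noteq> 0"
      using nonvanishing_circle[OF F(2) b2] by blast
    define c where "c = F1 (of_real r) / F2 (of_real r)"
    define S where "S = range (\<lambda>n::nat. \<rho> ^ n * of_real r)"
    have nz: "F2 (\<rho> ^ n * of_real r) \<noteq> 0" for n
      using r by (intro r) (auto simp: norm_mult norm_power \<rho>_def)
    \<comment> \<open>\<open>F1 - c * F2\<close> vanishes on the infinite orbit of a point under an irrational rotation.\<close>
    have orbit: "F1 (\<rho> ^ n * of_real r) - c * F2 (\<rho> ^ n * of_real r) = 0" for n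
    proof (induction n)
      case 0
      thus ?case using nz[of 0] by (simp add: c_def)
    next
      case (Suc n)
      thus ?case using nz[of n] D[of "\<rho> ^ n * of_real r"] by (simp add: mult_ac)
    qed
    have "inj (\<lambda>n. \<rho> ^ n * complex_of_real r)"
      using cis_power_inj[OF d] r(1) by (auto simp: inj_def \<rho>_def)
    hence "infinite S"
      unfolding S_def by (rule range_inj_infinite)
    moreover have "bounded S"
      unfolding S_def bounded_iff by (auto simp: norm_mult norm_power \<rho>_def)
    ultimately obtain x where x: "x islimpt S"
      using bounded_infinite_imp_islimpt by blast
    have mult: "F1 z - c * F2 z = 0" for z
      by (rule analytic_continuation[OF _ _ _ _ _ x])
         (use orbit in \<open>auto simp: S_def intro!: holomorphic_intros F\<close>)
    \<comment> \<open>The point where the zero-free circle meets the first line: there |F1| = |F2|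
      is not 0, which determines |c|.\<close>
    have "cmod c * cmod (F2 (e1 * of_real r)) = cmod (F2 (e1 * of_real r))"
      using norm_eq[of r] mult[of "e1 * of_real r"] by (simp add: norm_mult[symmetric])
    moreover have "F2 (e1 * of_real r) \<noteq> 0"
      using e(1) r by (intro r) (simp add: norm_mult)
    ultimately have "cmod c = 1" by simp
    thus ?thesis
      using mult by (intro exI[of _ c]) auto
  qed
qed

subsection \<open>Gaussian integrals and injectivity of the Fourier transform\<close>

lemma integrable_gaussian:
  fixes b :: real
  assumes "p > 0"
  shows "integrable lborel (\<lambda>x. exp (- p * x\<^sup>2 + b * x))"
proof -
  define \<sigma> where "\<sigma> = sqrt (1 / (2 * p))"
  have \<sigma>: "\<sigma> > 0" "\<sigma>\<^sup>2 = 1 / (2 * p)"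
    using assms by (auto simp: \<sigma>_def)
  have eq: "exp (- p * x\<^sup>2 + b * x) = (exp (b\<^sup>2 / (4 * p)) * sqrt (2 * pi * \<sigma>\<^sup>2)) * normal_density (b / (2 * p)) \<sigma> x" for x
  proof -
    have "- p * x\<^sup>2 + b * x = b\<^sup>2 / (4 * p) + - (x - b / (2 * p))\<^sup>2 / (2 * \<sigma>\<^sup>2)"
      unfolding \<sigma>(2) using assms by (simp add: field_simps power2_eq_square)
    hence "exp (- p * x\<^sup>2 + b * x) = exp (b\<^sup>2 / (4 * p)) * exp (- (x - b / (2 * p))\<^sup>2 / (2 * \<sigma>\<^sup>2))"
      by (simp only: exp_add)
    moreover have "sqrt (2 * pi * \<sigma>\<^sup>2) \<noteq> 0"
      using \<sigma>(1) by simp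
    ultimately show ?thesis
      unfolding normal_density_def by (simp del: real_sqrt_eq_0_iff real_sqrt_mult add: mult.assoc)
  qed
  show ?thesis
    unfolding eq by (intro integrable_mult_right integrable_normal_density \<sigma>(1))
qed

text \<open>Substituting x = t + s y completes the square with t = Re c / (4 pi) and scales to the
  standard normal density with s = 1 / (2 sqrt pi). The imaginary part of \<open>c\<close> then
  enters as the argument of the normal characteristic function, so no contour is shifted.\<close>

lemma gaussian_integral:
  fixes c :: complex
  shows "(LBINT x. exp (- 2 * of_real pi * (of_real x)\<^sup>2 + c * of_real x)) = exp (c\<^sup>2 / (8 * of_real pi)) / of_real (sqrt 2)"
proof -
  define s where "s = 1 / (2 * sqrt pi)"
  define t where "t = Re c / (4 * pi)"
  define \<beta> where "\<beta> = Im c"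
  have s: "s > 0" "s\<^sup>2 = 1 / (4 * pi)"
    by (auto simp: s_def power_divide power_mult_distrib)
  have "(LBINT x. std_normal_density x *\<^sub>R iexp (\<beta> * s * x)) = char std_normal_distribution (\<beta> * s)"
    unfolding char_def by (subst integral_density) (auto simp: normal_density_nonneg)
  hence std: "(LBINT x. std_normal_density x *\<^sub>R iexp (\<beta> * s * x)) = of_real (exp (- (\<beta> * s)\<^sup>2 / 2))"
    by (simp add: char_std_normal_distribution)
  have eq: "exp (- 2 * of_real pi * (of_real (t + s * x))\<^sup>2 + c * of_real (t + s * x)) =
      (of_real (sqrt (2 * pi)) * exp (of_real (2 * pi * t\<^sup>2) + \<i> * of_real (\<beta> * t))) * (std_normal_density x *\<^sub>R iexp (\<beta> * s * x))" for x
  proof -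
    have c: "c = of_real (4 * pi * t) + \<i> * of_real \<beta>"
      by (simp add: complex_eq_iff t_def \<beta>_def)
    have "- 2 * of_real pi * (of_real (t + s * x))\<^sup>2 + c * of_real (t + s * x) =
        of_real (- 2 * pi * (t + s * x)\<^sup>2 + 4 * pi * t * (t + s * x)) + \<i> * of_real (\<beta> * (t + s * x))"
      unfolding c by (simp add: algebra_simps)
    also have "- 2 * pi * (t + s * x)\<^sup>2 + 4 * pi * t * (t + s * x) = 2 * pi * t\<^sup>2 - 2 * pi * s\<^sup>2 * x\<^sup>2"
      by (simp add: algebra_simps power2_eq_square)
    also have "\<dots> = 2 * pi * t\<^sup>2 + - x\<^sup>2 / 2"
      unfolding s(2) by simp
    also have "of_real (2 * pi * t\<^sup>2 + - x\<^sup>2 / 2) + \<i> * of_real (\<beta> * (t + s * x)) =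
        (of_real (2 * pi * t\<^sup>2) + \<i> * of_real (\<beta> * t)) + (of_real (- x\<^sup>2 / 2) + \<i> * of_real (\<beta> * s * x))"
      by (simp add: algebra_simps)
    finally have "exp (- 2 * of_real pi * (of_real (t + s * x))\<^sup>2 + c * of_real (t + s * x)) =
       exp (of_real (2 * pi * t\<^sup>2) + \<i> * of_real (\<beta> * t)) * (of_real (exp (- x\<^sup>2 / 2)) * iexp (\<beta> * s * x))"
      by (simp only: exp_add exp_of_real)
    thus ?thesis
      unfolding std_normal_density_def by (simp add: scaleR_conv_of_real)
  qed
  have "(LBINT x. exp (- 2 * of_real pi * (of_real x)\<^sup>2 + c * of_real x)) =
      \<bar>s\<bar> *\<^sub>R (LBINT x. exp (- 2 * of_real pi * (of_real (t + s * x))\<^sup>2 + c * of_real (t + s * x)))"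
    using s by (intro lborel_integral_real_affine) auto
  also have "\<dots> = of_real (s * sqrt (2 * pi)) * (exp (of_real (2 * pi * t\<^sup>2) + \<i> * of_real (\<beta> * t)) * of_real (exp (- (\<beta> * s)\<^sup>2 / 2)))"
    unfolding eq integral_mult_right_zero std using s by (simp add: scaleR_conv_of_real)
  also have "s * sqrt (2 * pi) = 1 / sqrt 2"
    by (simp add: s_def real_sqrt_mult field_simps)
  also have "exp (of_real (2 * pi * t\<^sup>2) + \<i> * of_real (\<beta> * t)) * of_real (exp (- (\<beta> * s)\<^sup>2 / 2)) =
      exp (c\<^sup>2 / (8 * of_real pi))"
  proof -
    have "of_real (2 * pi * t\<^sup>2) + \<i> * of_real (\<beta> * t) + of_real (- (\<beta> * s)\<^sup>2 / 2) = c\<^sup>2 / (8 * of_real pi)"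
      unfolding power_mult_distrib s(2) by (simp add: complex_eq_iff t_def \<beta>_def power2_eq_square field_simps)
    thus ?thesis
      by (metis exp_add exp_of_real)
  qed
  finally show ?thesis
    by (simp add: mult.assoc)
qed

text \<open>The positive and negative parts of \<open>h\<close> have equal Fourier transforms, and
  at s = 0 equal mass m. Divided by m they are probability densities with the same characteristic
  function, so Levy's uniqueness theorem applies; m = 0 must be treated apart, where both parts
  vanish almost everywhere.\<close>

lemma fourier_injective_real:
  fixes h :: "real \<Rightarrow> real"
  assumes h: "integrable lborel h" and zero: "\<And>s. (LBINT x. h x *\<^sub>R iexp (s * x)) = 0"
  shows "AE x in lborel. h x = 0"
proof -
  define hp where "hp = (\<lambda>x. max 0 (h x))"
  define hm where "hm = (\<lambda>x. max 0 (- h x))"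
  have int: "integrable lborel hp" "integrable lborel hm"
    unfolding hp_def hm_def using h by (auto intro!: integrable_max)
  have nn: "hp x \<ge> 0" "hm x \<ge> 0" for x
    by (auto simp: hp_def hm_def)
  have diff: "h x = hp x - hm x" for x
    by (auto simp: hp_def hm_def max_def)
  have int': "integrable lborel (\<lambda>x. g x *\<^sub>R iexp (s * x))" if "integrable lborel g" for g s
    using integrable_norm[OF that] by (rule Bochner_Integration.integrable_bound) (use that in auto)
  have same: "(LBINT x. hp x *\<^sub>R iexp (s * x)) = (LBINT x. hm x *\<^sub>R iexp (s * x))" for s
    using Bochner_Integration.integral_diff[OF int'[OF int(1), of s] int'[OF int(2), of s]] zero[of s]
    by (simp add: diff scaleR_left_diff_distrib)
  define m where "m = (LBINT x. hp x)"
  have m: "(LBINT x. hm x) = m" 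
    using same[of 0] by (simp add: m_def flip: of_real_eq_iff integral_of_real) (simp add: scaleR_conv_of_real)
  have "m \<ge> 0" unfolding m_def by (intro integral_nonneg_AE) (simp add: nn)
  show ?thesis
  proof (cases "m = 0")
    case True
    hence "AE x in lborel. hp x = 0" "AE x in lborel. hm x = 0"
      using m integral_nonneg_eq_0_iff_AE[OF int(1)] integral_nonneg_eq_0_iff_AE[OF int(2)] nn by (auto simp: m_def)
    thus ?thesis by eventually_elim (simp add: diff)
  next
    case False
    hence "m > 0" using \<open>m \<ge> 0\<close> by simp
    define M where "M = (\<lambda>k :: real \<Rightarrow> real. density lborel (\<lambda>x. ennreal (k x / m)))"
    have meas: "hp \<in> borel_measurable borel" "hm \<in> borel_measurable borel"
      using int by (auto dest: borel_measurable_integrable)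
    have distr: "real_distribution (M k)" if k: "integrable lborel k" "\<And>x. k x \<ge> 0" "(LBINT x. k x) = m" for k
    proof -
      have km: "k \<in> borel_measurable borel" using k(1) by (auto dest: borel_measurable_integrable)
      have "emeasure (M k) (space (M k)) = (\<integral>\<^sup>+x. ennreal (k x / m) \<partial>lborel)"
        unfolding M_def using km by (subst emeasure_density) auto
      also have "\<dots> = ennreal (LBINT x. k x / m)"
        using k \<open>m > 0\<close> by (intro nn_integral_eq_integral) auto
      also have "\<dots> = 1" using k \<open>m > 0\<close> by simp
      finally have "prob_space (M k)" by (rule prob_spaceI)
      thus ?thesis
        unfolding real_distribution_def real_distribution_axioms_def by (simp add: M_def)
    qed
    have ch: "char (M k) s = (LBINT x. k x *\<^sub>R iexp (s * x)) / of_real m" if k: "integrable lborel k" "\<And>x. k x \<ge> 0" for k s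
    proof -
      have km: "k \<in> borel_measurable borel" using k(1) by (auto dest: borel_measurable_integrable)
      have "char (M k) s = (LBINT x. (k x / m) *\<^sub>R iexp (s * x))"
        unfolding char_def M_def using km k(2) \<open>m > 0\<close> by (subst integral_density) auto
      also have "\<dots> = (LBINT x. (k x *\<^sub>R iexp (s * x)) / of_real m)"
        by (intro Bochner_Integration.integral_cong) (auto simp: scaleR_conv_of_real)
      finally show ?thesis by simp
    qed
    have "M hp = M hm"
    proof (rule Levy_uniqueness)
      show "real_distribution (M hp)" "real_distribution (M hm)"
        by (auto intro!: distr int nn simp: m m_def)
      show "char (M hp) = char (M hm)"
        by (rule ext) (simp only: ch[OF int(1) nn(1)] ch[OF int(2) nn(2)] same)
    qed
    hence "AE x in lborel. ennreal (hp x / m) = ennreal (hm x / m)"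
      unfolding M_def using meas
      by (subst (asm) sigma_finite_measure.density_unique_iff[OF lborel.sigma_finite_measure_axioms]) auto
    thus ?thesis
      by eventually_elim (use \<open>m > 0\<close> nn in \<open>simp add: diff\<close>)
  qed
qed

text \<open>The transform of the conjugate of \<open>g\<close> at s is the conjugate of that of
  \<open>g\<close> at - s, so it vanishes too, and with it the transforms of the real and imaginary
  parts.\<close>

lemma fourier_injective_lborel:
  fixes g :: "real \<Rightarrow> complex"
  assumes g: "integrable lborel g" and zero: "\<And>s. (LBINT x. g x * iexp (s * x)) = 0"
  shows "AE x in lborel. g x = 0"
proof -
  have int: "integrable lborel (\<lambda>x. k x * iexp (s * x))" if "integrable lborel k" for k :: "real \<Rightarrow> complex" and s
    using integrable_norm[OF that] by (rule Bochner_Integration.integrable_bound) (use that in \<open>auto simp: norm_mult\<close>)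
  have gc: "integrable lborel (\<lambda>x. cnj (g x))"
    using g by simp
  have cnj: "(LBINT x. cnj (g x) * iexp (s * x)) = 0" for s
  proof -
    have "(LBINT x. cnj (g x) * iexp (s * x)) = cnj (LBINT x. g x * iexp (- s * x))"
      unfolding Bochner_Integration.integral_cnj[symmetric] by (intro Bochner_Integration.integral_cong) (auto simp: exp_cnj)
    thus ?thesis unfolding zero by simp
  qed
  have "AE x in lborel. Re (g x) = 0"
  proof (rule fourier_injective_real)
    show "(LBINT x. Re (g x) *\<^sub>R iexp (s * x)) = 0" for s
    proof -
      have "(LBINT x. Re (g x) *\<^sub>R iexp (s * x)) = (LBINT x. (g x * iexp (s * x) + cnj (g x) * iexp (s * x)) / 2)"
        by (intro Bochner_Integration.integral_cong) (auto simp: scaleR_conv_of_real complex_add_cnj distrib_right[symmetric])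
      also have "\<dots> = ((LBINT x. g x * iexp (s * x)) + (LBINT x. cnj (g x) * iexp (s * x))) / 2"
        unfolding integral_divide_zero using Bochner_Integration.integral_add[OF int[OF g, of s] int[OF gc, of s]] by simp
      finally show ?thesis
        unfolding zero cnj by simp
    qed
  qed (use g in auto)
  moreover have "AE x in lborel. Im (g x) = 0"
  proof (rule fourier_injective_real)
    show "(LBINT x. Im (g x) *\<^sub>R iexp (s * x)) = 0" for s
    proof -
      have "(LBINT x. Im (g x) *\<^sub>R iexp (s * x)) = (LBINT x. (g x * iexp (s * x) - cnj (g x) * iexp (s * x)) / (2 * \<i>))"
      proof (intro Bochner_Integration.integral_cong refl)
        fix x
        have "complex_of_real (Im (g x)) = (g x - cnj (g x)) / (2 * \<i>)"
          by (simp add: complex_eq_iff)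
        thus "Im (g x) *\<^sub>R iexp (s * x) = (g x * iexp (s * x) - cnj (g x) * iexp (s * x)) / (2 * \<i>)"
          by (simp only: scaleR_conv_of_real left_diff_distrib times_divide_eq_left)
      qed
      also have "\<dots> = ((LBINT x. g x * iexp (s * x)) - (LBINT x. cnj (g x) * iexp (s * x))) / (2 * \<i>)"
        unfolding integral_divide_zero using Bochner_Integration.integral_diff[OF int[OF g, of s] int[OF gc, of s]] by simp
      finally show ?thesis
        unfolding zero cnj by simp
    qed
  qed (use g in auto)
  ultimately show ?thesis
    by eventually_elim (simp add: complex_eq_iff)
qed

text \<open>Lebesgue measurability is reduced to Borel measurability by changing \<open>g\<close> on
  a null set.\<close>

lemma fourier_injective:
  fixes g :: "real \<Rightarrow> complex"
  assumes g: "integrable lebesgue g" and zero: "\<And>s. (LINT x|lebesgue. g x * iexp (s * x)) = 0"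
  shows "AE x in lebesgue. g x = 0"
proof -
  obtain r i where ri: "r \<in> borel_measurable lborel" "AE x in lborel. Re (g x) = r x"
      "i \<in> borel_measurable lborel" "AE x in lborel. Im (g x) = i x"
    using completion_ex_borel_measurable_real[of "\<lambda>x. Re (g x)" lborel]
      completion_ex_borel_measurable_real[of "\<lambda>x. Im (g x)" lborel] borel_measurable_integrable[OF g] by auto
  define g' where "g' = (\<lambda>x. Complex (r x) (i x))"
  have g': "g' \<in> borel_measurable lborel" "AE x in lborel. g x = g' x"
  proof -
    show "g' \<in> borel_measurable lborel"
      unfolding g'_def Complex_eq using ri(1,3) by measurable
    show "AE x in lborel. g x = g' x"
      using ri(2,4) by eventually_elim (simp add: g'_def complex_eq_iff)
  qed
  have g'2: "AE x in lebesgue. g x = g' x"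
    using g'(2) by (rule AE_completion)
  have "integrable lebesgue g'"
    by (rule integrable_cong_AE_imp[OF g measurable_completion[OF g'(1)]]) (use g'2 in \<open>auto elim: eventually_mono\<close>)
  hence int: "integrable lborel g'"
    using g'(1) integrable_completion by blast
  have "AE x in lborel. g' x = 0"
  proof (rule fourier_injective_lborel[OF int])
    fix s
    have "(LBINT x. g' x * iexp (s * x)) = (LINT x|lebesgue. g' x * iexp (s * x))"
      using g'(1) by (intro integral_completion[symmetric]) auto
    also have "\<dots> = (LINT x|lebesgue. g x * iexp (s * x))"
    proof (rule integral_cong_AE)
      have [measurable]: "(\<lambda>x. iexp (s * x)) \<in> borel_measurable lebesgue"
        by (rule measurable_completion) measurable
      have [measurable]: "g \<in> borel_measurable lebesgue" "g' \<in> borel_measurable lebesgue"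
        using g g'(1) by (auto intro: measurable_completion)
      show "(\<lambda>x. g' x * iexp (s * x)) \<in> borel_measurable lebesgue" "(\<lambda>x. g x * iexp (s * x)) \<in> borel_measurable lebesgue"
        by measurable
    qed (use g'2 in \<open>auto elim: eventually_mono\<close>)
    finally show "(LBINT x. g' x * iexp (s * x)) = 0"
      unfolding zero .
  qed
  hence "AE x in lebesgue. g' x = 0"
    by (rule AE_completion)
  thus ?thesis
    using g'2 by eventually_elim simp
qed

subsection \<open>The Bargmann transform\<close>

text \<open>The Bargmann transform for the weight exp (- pi |z|^2), without the usual factor 2 powr
  (1/4); its square reappears as the \<open>sqrt 2\<close> in the construction of preimages.\<close>

definition bargmann :: "(real \<Rightarrow> complex) \<Rightarrow> complex \<Rightarrow> complex" where
  "bargmann f z = exp (- of_real pi * z\<^sup>2 / 2) *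
     (LINT x|lebesgue. f x * exp (- of_real pi * (of_real x)\<^sup>2 + 2 * of_real pi * of_real x * z))"

lemma gabor_bargmann:
  "gabor f (t, \<omega>) = exp (of_real pi * (Complex t (- \<omega>))\<^sup>2 / 2 - of_real (pi * t\<^sup>2)) * bargmann f (Complex t (- \<omega>))"
proof -
  define z where "z = Complex t (- \<omega>)"
  have "gabor f (t, \<omega>) =
      (LINT x|lebesgue. exp (- of_real (pi * t\<^sup>2)) * (f x * exp (- of_real pi * (of_real x)\<^sup>2 + 2 * of_real pi * of_real x * z)))"
    unfolding gabor_def prod.case
  proof (intro Bochner_Integration.integral_cong refl)
    fix x
    have "complex_of_real (gauss (x - t)) * exp (- 2 * pi * \<i> * x * \<omega>) =
        exp (of_real (- pi * (x - t)\<^sup>2) + - 2 * pi * \<i> * x * \<omega>)"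
      unfolding gauss_def exp_of_real[symmetric] by (simp only: exp_add)
    also have "of_real (- pi * (x - t)\<^sup>2) + - 2 * pi * \<i> * x * \<omega> =
        - of_real (pi * t\<^sup>2) + (- of_real pi * (of_real x)\<^sup>2 + 2 * of_real pi * of_real x * z)"
      by (simp add: complex_eq_iff z_def power2_eq_square algebra_simps)
    also have "exp \<dots> = exp (- of_real (pi * t\<^sup>2)) * exp (- of_real pi * (of_real x)\<^sup>2 + 2 * of_real pi * of_real x * z)"
      by (rule exp_add)
    finally show "f x * complex_of_real (gauss (x - t)) * exp (- 2 * pi * \<i> * x * \<omega>) =
        exp (- of_real (pi * t\<^sup>2)) * (f x * exp (- of_real pi * (of_real x)\<^sup>2 + 2 * of_real pi * of_real x * z))"
      by (simp only: mult.assoc mult.left_commute)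
  qed
  also have "\<dots> = exp (- of_real (pi * t\<^sup>2)) *
      (LINT x|lebesgue. f x * exp (- of_real pi * (of_real x)\<^sup>2 + 2 * of_real pi * of_real x * z))"
    by (rule integral_mult_right_zero)
  also have "exp (- of_real (pi * t\<^sup>2)) =
      exp (of_real pi * z\<^sup>2 / 2 - of_real (pi * t\<^sup>2)) * exp (- of_real pi * z\<^sup>2 / 2)"
    unfolding exp_add[symmetric] by (rule arg_cong[where f = exp]) simp
  finally have "gabor f (t, \<omega>) = exp (of_real pi * z\<^sup>2 / 2 - of_real (pi * t\<^sup>2)) * bargmann f z"
    by (simp only: bargmann_def mult.assoc)
  thus ?thesis
    unfolding z_def .
qed

lemma integrable_gaussian_lebesgue:
  fixes p b :: real
  assumes "p > 0"
  shows "integrable lebesgue (\<lambda>x. exp (- p * x\<^sup>2 + b * x))"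
  using integrable_gaussian[OF assms, of b] by (subst integrable_completion) (auto intro!: borel_measurable_integrable)

text \<open>The inequality ab <= a^2/2 + b^2/2 takes the place of Cauchy-Schwarz, since the size of
  constants never matters here.\<close>

lemma integrable_mult_square:
  fixes f :: "real \<Rightarrow> complex" and g :: "real \<Rightarrow> real"
  assumes f: "square_integrable f" and g: "g \<in> borel_measurable lebesgue" "integrable lebesgue (\<lambda>x. (g x)\<^sup>2)"
  shows "integrable lebesgue (\<lambda>x. cmod (f x) * g x)"
    and "(LINT x|lebesgue. cmod (f x) * g x) \<le> (LINT x|lebesgue. (cmod (f x))\<^sup>2) / 2 + (LINT x|lebesgue. (g x)\<^sup>2) / 2"
proof -
  have [measurable]: "f \<in> borel_measurable lebesgue" "g \<in> borel_measurable lebesgue"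
    and f2: "integrable lebesgue (\<lambda>x. (cmod (f x))\<^sup>2)"
    using f g by (auto simp: square_integrable_def)
  have amgm: "\<bar>a * b\<bar> \<le> a\<^sup>2 / 2 + b\<^sup>2 / 2" for a b :: real
    using sum_squares_bound[of a b] sum_squares_bound[of a "- b"] by (auto simp: abs_if)
  have int: "integrable lebesgue (\<lambda>x. (cmod (f x))\<^sup>2 / 2 + (g x)\<^sup>2 / 2)"
    using f2 g(2) by simp
  show 1: "integrable lebesgue (\<lambda>x. cmod (f x) * g x)"
  proof (rule Bochner_Integration.integrable_bound[OF int])
    show "AE x in lebesgue. norm (cmod (f x) * g x) \<le> norm ((cmod (f x))\<^sup>2 / 2 + (g x)\<^sup>2 / 2)"
      using amgm by (intro AE_I2) (metis abs_of_nonneg add_nonneg_nonneg divide_nonneg_nonneg real_norm_def zero_le_numeral zero_le_power2)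
  qed measurable
  have "(LINT x|lebesgue. cmod (f x) * g x) \<le> (LINT x|lebesgue. (cmod (f x))\<^sup>2 / 2 + (g x)\<^sup>2 / 2)"
    by (intro integral_mono 1 int order_trans[OF abs_ge_self amgm])
  also have "\<dots> = (LINT x|lebesgue. (cmod (f x))\<^sup>2) / 2 + (LINT x|lebesgue. (g x)\<^sup>2) / 2"
    using f2 g(2) by simp
  finally show "(LINT x|lebesgue. cmod (f x) * g x) \<le> (LINT x|lebesgue. (cmod (f x))\<^sup>2) / 2 + (LINT x|lebesgue. (g x)\<^sup>2) / 2" .
qed

lemma borel_measurable_lebesgue:
  "g \<in> borel_measurable borel \<Longrightarrow> g \<in> borel_measurable lebesgue"
  by (rule measurable_completion) simp

text \<open>The absolute value in the exponent makes this function dominate every partial sum of the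
  expanded exponential, uniformly in the argument of z. Its square is split by exp (2 r |x|) <= exp
  (2 r x) + exp (- 2 r x).\<close>

lemma integrable_bargmann_abs:
  assumes f: "square_integrable f"
  shows "integrable lebesgue (\<lambda>x. cmod (f x) * exp (- pi * x\<^sup>2 + r * \<bar>x\<bar>))"
proof (rule integrable_mult_square(1)[OF f])
  show [measurable]: "(\<lambda>x. exp (- pi * x\<^sup>2 + r * \<bar>x\<bar>)) \<in> borel_measurable lebesgue"
    by (rule borel_measurable_lebesgue) measurable
  show "integrable lebesgue (\<lambda>x. (exp (- pi * x\<^sup>2 + r * \<bar>x\<bar>))\<^sup>2)"
  proof (rule Bochner_Integration.integrable_bound)
    show "integrable lebesgue (\<lambda>x. exp (- (2 * pi) * x\<^sup>2 + (2 * r) * x) + exp (- (2 * pi) * x\<^sup>2 + (- 2 * r) * x))"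
      by (intro Bochner_Integration.integrable_add integrable_gaussian_lebesgue) auto
    have "(exp (- pi * x\<^sup>2 + r * \<bar>x\<bar>))\<^sup>2 \<le>
        exp (- (2 * pi) * x\<^sup>2 + (2 * r) * x) + exp (- (2 * pi) * x\<^sup>2 + (- 2 * r) * x)" for x
      by (auto simp: abs_if exp_double[symmetric] algebra_simps)
    from order_trans[OF this abs_ge_self]
    show "AE x in lebesgue. norm ((exp (- pi * x\<^sup>2 + r * \<bar>x\<bar>))\<^sup>2) \<le>
        norm (exp (- (2 * pi) * x\<^sup>2 + (2 * r) * x) + exp (- (2 * pi) * x\<^sup>2 + (- 2 * r) * x))"
      by (intro AE_I2) simp
  qed measurable
qed

lemma integrable_bargmann:
  assumes f: "square_integrable f"
  shows "integrable lebesgue (\<lambda>x. f x * exp (- of_real pi * (of_real x)\<^sup>2 + 2 * of_real pi * of_real x * z))"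
proof (rule Bochner_Integration.integrable_bound[OF integrable_bargmann_abs[OF f, of "2 * pi * cmod z"]])
  have [measurable]: "(\<lambda>x. exp (- of_real pi * (of_real x)\<^sup>2 + 2 * of_real pi * of_real x * z)) \<in> borel_measurable lebesgue"
    by (rule borel_measurable_lebesgue) measurable
  have [measurable]: "f \<in> borel_measurable lebesgue"
    using f by (simp add: square_integrable_def)
  show "(\<lambda>x. f x * exp (- of_real pi * (of_real x)\<^sup>2 + 2 * of_real pi * of_real x * z)) \<in> borel_measurable lebesgue"
    by measurable
  have "x * Re z \<le> cmod z * \<bar>x\<bar>" for x
  proof -
    have "x * Re z \<le> \<bar>Re z\<bar> * \<bar>x\<bar>"
      using abs_ge_self[of "x * Re z"] by (simp add: abs_mult mult.commute)
    also have "\<dots> \<le> cmod z * \<bar>x\<bar>"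
      by (intro mult_right_mono abs_Re_le_cmod) auto
    finally show ?thesis .
  qed
  hence "2 * pi * (x * Re z) \<le> 2 * pi * (cmod z * \<bar>x\<bar>)" for x
    by (intro mult_left_mono) auto
  thus "AE x in lebesgue. norm (f x * exp (- of_real pi * (of_real x)\<^sup>2 + 2 * of_real pi * of_real x * z))
      \<le> norm (cmod (f x) * exp (- pi * x\<^sup>2 + 2 * pi * cmod z * \<bar>x\<bar>))"
    by (intro AE_I2) (auto simp: norm_mult norm_exp_eq_Re mult.assoc intro!: mult_left_mono)
qed

text \<open>With t = Re z the integrand has modulus exp (pi t^2) |f x| exp (- pi (x - t)^2), and the
  L2 norm of the shifted Gaussian does not depend on t. The prefactor turns exp (pi t^2) into
  exactly exp (pi |z|^2 / 2).\<close>

lemma bargmann_growth: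
  assumes f: "square_integrable f"
  shows "\<exists>C. \<forall>z. cmod (bargmann f z) \<le> C * exp (pi / 2 * (cmod z)\<^sup>2)"
proof (intro exI allI)
  fix z :: complex
  define t where "t = Re z"
  define \<sigma> where "\<sigma> = 1 / (2 * sqrt pi)"
  have \<sigma>: "\<sigma> > 0" "\<sigma>\<^sup>2 = 1 / (4 * pi)"
    by (auto simp: \<sigma>_def power_divide power_mult_distrib)
  have g: "(exp (- pi * (x - t)\<^sup>2))\<^sup>2 = sqrt (1 / 2) * normal_density t \<sigma> x" for x
    unfolding normal_density_def \<sigma>(2) by (simp add: exp_double[symmetric] real_sqrt_divide field_simps)
  have gint: "integrable lebesgue (\<lambda>x. (exp (- pi * (x - t)\<^sup>2))\<^sup>2)"
    unfolding g by (subst integrable_completion) (auto intro!: integrable_mult_right integrable_normal_density \<sigma>(1))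
  have gval: "(LINT x|lebesgue. (exp (- pi * (x - t)\<^sup>2))\<^sup>2) = sqrt (1 / 2)"
    unfolding g by (subst integral_completion) (auto simp: \<sigma>(1))
  have meas: "(\<lambda>x. exp (- pi * (x - t)\<^sup>2)) \<in> borel_measurable lebesgue"
    by (rule borel_measurable_lebesgue) measurable
  have "cmod (LINT x|lebesgue. f x * exp (- of_real pi * (of_real x)\<^sup>2 + 2 * of_real pi * of_real x * z)) \<le>
      (LINT x|lebesgue. cmod (f x * exp (- of_real pi * (of_real x)\<^sup>2 + 2 * of_real pi * of_real x * z)))"
    by (rule integral_norm_bound)
  also have "\<dots> = (LINT x|lebesgue. exp (pi * t\<^sup>2) * (cmod (f x) * exp (- pi * (x - t)\<^sup>2)))"
    by (intro Bochner_Integration.integral_cong refl)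
       (simp add: norm_mult norm_exp_eq_Re t_def exp_add[symmetric] power2_eq_square algebra_simps)
  also have "\<dots> = exp (pi * t\<^sup>2) * (LINT x|lebesgue. cmod (f x) * exp (- pi * (x - t)\<^sup>2))"
    by simp
  also have "\<dots> \<le> exp (pi * t\<^sup>2) * ((LINT x|lebesgue. (cmod (f x))\<^sup>2) / 2 + sqrt (1 / 2) / 2)"
    using integrable_mult_square(2)[OF f meas gint] unfolding gval by (intro mult_left_mono) auto
  finally have *: "cmod (LINT x|lebesgue. f x * exp (- of_real pi * (of_real x)\<^sup>2 + 2 * of_real pi * of_real x * z)) \<le>
      exp (pi * t\<^sup>2) * ((LINT x|lebesgue. (cmod (f x))\<^sup>2) / 2 + sqrt (1 / 2) / 2)" .
  have "Re (- of_real pi * z\<^sup>2 / 2) + pi * t\<^sup>2 = pi / 2 * (cmod z)\<^sup>2"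
    unfolding cmod_power2 by (simp add: t_def power2_eq_square field_simps)
  hence e: "exp (Re (- of_real pi * z\<^sup>2 / 2)) * exp (pi * t\<^sup>2) = exp (pi / 2 * (cmod z)\<^sup>2)"
    by (simp only: exp_add[symmetric])
  have "cmod (bargmann f z) \<le> exp (Re (- of_real pi * z\<^sup>2 / 2)) *
      (exp (pi * t\<^sup>2) * ((LINT x|lebesgue. (cmod (f x))\<^sup>2) / 2 + sqrt (1 / 2) / 2))"
    unfolding bargmann_def norm_mult norm_exp_eq_Re by (intro mult_left_mono *) auto
  also have "\<dots> = ((LINT x|lebesgue. (cmod (f x))\<^sup>2) / 2 + sqrt (1 / 2) / 2) * exp (pi / 2 * (cmod z)\<^sup>2)"
    unfolding mult.assoc[symmetric] e by simp
  finally show "cmod (bargmann f z) \<le> ((LINT x|lebesgue. (cmod (f x))\<^sup>2) / 2 + sqrt (1 / 2) / 2) * exp (pi / 2 * (cmod z)\<^sup>2)" .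
qed

text \<open>Expanding exp (2 pi x z) and integrating termwise gives a power series in z that
  converges everywhere; the sum of the moduli of the terms is the integrable function
  \<open>M\<close>.\<close>

lemma bargmann_holomorphic:
  assumes f: "square_integrable f"
  shows "bargmann f holomorphic_on UNIV"
proof -
  define L where "L = (\<lambda>z. LINT x|lebesgue. f x * exp (- of_real pi * (of_real x)\<^sup>2 + 2 * of_real pi * of_real x * z))"
  define c where "c = (\<lambda>k. LINT x|lebesgue. f x * exp (- of_real pi * (of_real x)\<^sup>2) * ((2 * of_real pi * of_real x) ^ k / fact k))"
  have [measurable]: "f \<in> borel_measurable lebesgue"
    using f by (simp add: square_integrable_def)
  have sums: "(\<lambda>k. c k * z ^ k) sums L z" for z
  proof -
    define h where "h = (\<lambda>k x. f x * exp (- of_real pi * (of_real x)\<^sup>2) * ((2 * of_real pi * of_real x * z) ^ k / fact k))"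
    define r where "r = 2 * pi * cmod z"
    define M where "M = (\<lambda>x. cmod (f x) * exp (- pi * x\<^sup>2 + r * \<bar>x\<bar>))"
    have M: "integrable lebesgue M"
      unfolding M_def by (rule integrable_bargmann_abs[OF f])
    have nh: "norm (h k x) = cmod (f x) * exp (- pi * x\<^sup>2) * ((r * \<bar>x\<bar>) ^ k / fact k)" for k x
      by (simp add: h_def norm_mult norm_divide norm_power norm_exp_eq_Re r_def mult_ac flip: of_real_power)
    have exps: "(\<lambda>k. norm (h k x)) sums M x" for x
    proof -
      have "(\<lambda>k. (r * \<bar>x\<bar>) ^ k / fact k) sums exp (r * \<bar>x\<bar>)"
        using exp_converges[of "r * \<bar>x\<bar>"] by (simp add: field_simps)
      from sums_mult[OF this, of "cmod (f x) * exp (- pi * x\<^sup>2)"] show ?thesis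
        unfolding nh M_def exp_add by (simp add: mult.assoc)
    qed
    have partial: "(\<Sum>k<n. norm (h k x)) \<le> M x" for n x
      using exps by (intro sum_le_suminf[THEN order_trans]) (auto simp: sums_iff)
    have [measurable]: "(\<lambda>x. exp (- of_real pi * (of_real x)\<^sup>2) * ((2 * of_real pi * of_real x * z) ^ k / fact k)) \<in> borel_measurable lebesgue" for k
      by (rule borel_measurable_lebesgue) measurable
    have hmeas [measurable]: "h k \<in> borel_measurable lebesgue" for k
      unfolding h_def mult.assoc[of "f _"] by measurable
    have hint: "integrable lebesgue (h k)" for k
    proof (rule Bochner_Integration.integrable_bound[OF M hmeas])
      have "norm (h k x) \<le> M x" for x
        using partial[of x "Suc k"] sum_nonneg[of "{..<k}" "\<lambda>k. norm (h k x)"] by simp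
      thus "AE x in lebesgue. norm (h k x) \<le> norm (M x)"
        by (intro AE_I2) (smt (verit) real_norm_def)
    qed
    have "(\<lambda>k. integral\<^sup>L lebesgue (h k)) sums (LINT x|lebesgue. (\<Sum>k. h k x))"
    proof (rule sums_integral[OF hint])
      show "AE x in lebesgue. summable (\<lambda>k. norm (h k x))"
        using exps by (intro AE_I2) (auto simp: sums_iff)
      show "summable (\<lambda>k. LINT x|lebesgue. norm (h k x))"
      proof (rule summableI_nonneg_bounded)
        show "(\<Sum>k<n. LINT x|lebesgue. norm (h k x)) \<le> integral\<^sup>L lebesgue M" for n
        proof -
          have "(\<Sum>k<n. LINT x|lebesgue. norm (h k x)) = (LINT x|lebesgue. (\<Sum>k<n. norm (h k x)))"
            by (rule Bochner_Integration.integral_sum[symmetric]) (intro integrable_norm hint)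
          also have "\<dots> \<le> integral\<^sup>L lebesgue M"
            by (intro integral_mono M partial Bochner_Integration.integrable_sum integrable_norm hint)
          finally show ?thesis .
        qed
      qed simp
    qed
    moreover have "(\<Sum>k. h k x) = f x * exp (- of_real pi * (of_real x)\<^sup>2 + 2 * of_real pi * of_real x * z)" for x
    proof -
      have "(\<lambda>k. (2 * of_real pi * of_real x * z) ^ k / fact k) sums exp (2 * of_real pi * of_real x * z)"
        using exp_converges[of "2 * of_real pi * of_real x * z"] by (simp add: scaleR_conv_of_real field_simps)
      from sums_mult[OF this, of "f x * exp (- of_real pi * (of_real x)\<^sup>2)"] show ?thesis
        unfolding h_def exp_add by (simp add: sums_iff mult.assoc)
    qed
    moreover have "integral\<^sup>L lebesgue (h k) = c k * z ^ k" for k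
    proof -
      have "integral\<^sup>L lebesgue (h k) = (LINT x|lebesgue. f x * exp (- of_real pi * (of_real x)\<^sup>2) * ((2 * of_real pi * of_real x) ^ k / fact k) * z ^ k)"
        unfolding h_def by (intro Bochner_Integration.integral_cong refl) (simp add: power_mult_distrib mult_ac)
      thus ?thesis
        unfolding c_def by simp
    qed
    ultimately show ?thesis
      unfolding L_def by simp
  qed
  have "L field_differentiable at z" for z
  proof -
    have "L holomorphic_on ball 0 (cmod z + 1)"
      by (rule power_series_holomorphic) (use sums in simp)
    thus ?thesis
      by (rule holomorphic_on_imp_differentiable_at) auto
  qed
  hence "L holomorphic_on UNIV"
    by (simp add: holomorphic_on_def field_differentiable_at_within)
  moreover have "bargmann f = (\<lambda>z. exp (- of_real pi * z\<^sup>2 / 2) * L z)"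
    by (simp add: fun_eq_iff bargmann_def L_def)
  ultimately show ?thesis
    by (auto intro!: holomorphic_intros)
qed

text \<open>At z = i s / (2 pi) the integral is the Fourier transform of f x * exp (- pi x^2), an
  integrable function, and the Gaussian can be cancelled afterwards because it has no zeros.\<close>

lemma bargmann_injective:
  assumes f: "square_integrable f1" "square_integrable f2"
    and eq: "\<And>z. bargmann f1 z = c * bargmann f2 z"
  shows "AE x in lebesgue. f1 x = c * f2 x"
proof -
  let ?E = "\<lambda>x z. exp (- of_real pi * (of_real x)\<^sup>2 + 2 * of_real pi * of_real x * z) :: complex"
  have L: "(LINT x|lebesgue. f1 x * ?E x z) = c * (LINT x|lebesgue. f2 x * ?E x z)" for z
    using eq[of z] unfolding bargmann_def by simp
  define g where "g = (\<lambda>x. f1 x * ?E x 0 - c * (f2 x * ?E x 0))"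
  have "AE x in lebesgue. g x = 0"
  proof (rule fourier_injective)
    show "integrable lebesgue g"
      unfolding g_def by (intro Bochner_Integration.integrable_diff integrable_mult_right integrable_bargmann f)
    fix s
    define z where "z = \<i> * of_real (s / (2 * pi))"
    have E: "?E x 0 * iexp (s * x) = ?E x z" for x
      unfolding exp_add[symmetric] z_def by (intro arg_cong[where f = exp]) (simp add: field_simps)
    have "(LINT x|lebesgue. g x * iexp (s * x)) = (LINT x|lebesgue. f1 x * ?E x z - c * (f2 x * ?E x z))"
      unfolding g_def E[symmetric] by (intro Bochner_Integration.integral_cong refl) (simp only: left_diff_distrib mult.assoc)
    also have "\<dots> = (LINT x|lebesgue. f1 x * ?E x z) - (LINT x|lebesgue. c * (f2 x * ?E x z))"
      by (intro Bochner_Integration.integral_diff integrable_mult_right integrable_bargmann f)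
    also have "\<dots> = 0"
      unfolding L integral_mult_right_zero by simp
    finally show "(LINT x|lebesgue. g x * iexp (s * x)) = 0" .
  qed
  thus ?thesis
    by eventually_elim (simp add: g_def mult.assoc[symmetric] left_diff_distrib[symmetric])
qed

subsection \<open>Rotation invariance and the radial mean value property\<close>

lemma integrable_lborel_product:
  fixes g :: "'a::euclidean_space \<Rightarrow> real" and h :: "'b::euclidean_space \<Rightarrow> real"
  assumes g: "integrable lborel g" and h: "integrable lborel h"
  shows "integrable (lborel :: ('a \<times> 'b) measure) (\<lambda>p. g (fst p) * h (snd p))"
    and "integral\<^sup>L (lborel :: ('a \<times> 'b) measure) (\<lambda>p. g (fst p) * h (snd p)) = integral\<^sup>L lborel g * integral\<^sup>L lborel h"
proof -
  have [measurable]: "g \<in> borel_measurable borel" "h \<in> borel_measurable borel"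
    using g h by (auto dest: borel_measurable_integrable)
  have 1: "integrable (lborel \<Otimes>\<^sub>M lborel) (\<lambda>p. g (fst p) * h (snd p))"
  proof (rule lborel_pair.Fubini_integrable)
    show "integrable lborel (\<lambda>x. LBINT y. norm (g (fst (x, y)) * h (snd (x, y))))"
      using g by (simp add: abs_mult)
  qed (use h in auto)
  show "integrable (lborel :: ('a \<times> 'b) measure) (\<lambda>p. g (fst p) * h (snd p))"
    using 1 by (simp add: lborel_prod)
  show "integral\<^sup>L (lborel :: ('a \<times> 'b) measure) (\<lambda>p. g (fst p) * h (snd p)) = integral\<^sup>L lborel g * integral\<^sup>L lborel h"
    using lborel_pair.integral_fst'[OF 1] by (simp add: lborel_prod)
qed

lemma Fubini_lborel:
  fixes f :: "'a::euclidean_space \<Rightarrow> 'b::euclidean_space \<Rightarrow> complex"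
  assumes "integrable (lborel :: ('a \<times> 'b) measure) (\<lambda>p. f (fst p) (snd p))"
  shows "(LBINT x. LBINT y. f x y) = (LBINT y. LBINT x. f x y)"
proof -
  have "integrable (lborel \<Otimes>\<^sub>M lborel) (case_prod f)"
    using assms by (simp add: lborel_prod case_prod_beta')
  thus ?thesis
    by (rule lborel_pair.Fubini_integral[symmetric])
qed

lemma fst_snd_borel [measurable]:
  "(fst :: 'a::euclidean_space \<times> 'b::euclidean_space \<Rightarrow> 'a) \<in> borel_measurable borel"
  "(snd :: 'a::euclidean_space \<times> 'b::euclidean_space \<Rightarrow> 'b) \<in> borel_measurable borel"
  by (intro borel_measurable_continuous_onI continuous_intros)+

lemma shear_measurable [measurable]:
  fixes a :: real
  shows "(\<lambda>p. (fst p + a * snd p, snd p)) \<in> borel_measurable borel" "(\<lambda>p. (fst p, snd p + a * fst p)) \<in> borel_measurable borel"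
  by (intro borel_measurable_continuous_onI continuous_intros)+

text \<open>Each horizontal line is merely translated, so Tonelli's theorem reduces the claim to
  translation invariance in one dimension.\<close>

lemma lborel_distr_shear_fst: "distr lborel borel (\<lambda>p::real\<times>real. (fst p + a * snd p, snd p)) = lborel"
proof (rule measure_eqI)
  fix A assume "A \<in> sets (distr lborel borel (\<lambda>p::real\<times>real. (fst p + a * snd p, snd p)))"
  hence [measurable]: "A \<in> sets borel" by simp
  hence [measurable]: "A \<in> sets (borel \<Otimes>\<^sub>M borel)" by (metis borel_prod)
  have "emeasure (distr lborel borel (\<lambda>p. (fst p + a * snd p, snd p))) A =
      (\<integral>\<^sup>+p. indicator A (fst p + a * snd p, snd p) \<partial>(lborel \<Otimes>\<^sub>M lborel))"
    unfolding lborel_prod by (subst nn_integral_indicator[symmetric], simp, subst nn_integral_distr) auto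
  also have "\<dots> = (\<integral>\<^sup>+v. \<integral>\<^sup>+u. indicator A (u + a * v, v) \<partial>lborel \<partial>lborel)"
    by (subst lborel_pair.nn_integral_snd[symmetric]) auto
  also have "\<dots> = (\<integral>\<^sup>+v. \<integral>\<^sup>+u. indicator A (u, v) \<partial>lborel \<partial>lborel)"
  proof (rule nn_integral_cong)
    fix v
    show "(\<integral>\<^sup>+u. indicator A (u + a * v, v) \<partial>lborel) = (\<integral>\<^sup>+u. indicator A (u, v) \<partial>lborel)"
      using nn_integral_real_affine[of "\<lambda>u. indicator A (u, v)" 1 "a * v"] by (simp add: add.commute)
  qed
  also have "\<dots> = (\<integral>\<^sup>+p. indicator A p \<partial>(lborel \<Otimes>\<^sub>M lborel))"
    by (subst lborel_pair.nn_integral_snd[symmetric]) auto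
  also have "\<dots> = emeasure lborel A"
    unfolding lborel_prod by simp
  finally show "emeasure (distr lborel borel (\<lambda>p. (fst p + a * snd p, snd p))) A = emeasure lborel A" .
qed simp

lemma lborel_distr_shear_snd: "distr lborel borel (\<lambda>p::real\<times>real. (fst p, snd p + a * fst p)) = lborel"
proof (rule measure_eqI)
  fix A assume "A \<in> sets (distr lborel borel (\<lambda>p::real\<times>real. (fst p, snd p + a * fst p)))"
  hence [measurable]: "A \<in> sets borel" by simp
  hence [measurable]: "A \<in> sets (borel \<Otimes>\<^sub>M borel)" by (metis borel_prod)
  have "emeasure (distr lborel borel (\<lambda>p. (fst p, snd p + a * fst p))) A =
      (\<integral>\<^sup>+p. indicator A (fst p, snd p + a * fst p) \<partial>(lborel \<Otimes>\<^sub>M lborel))"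
    unfolding lborel_prod by (subst nn_integral_indicator[symmetric], simp, subst nn_integral_distr) auto
  also have "\<dots> = (\<integral>\<^sup>+u. \<integral>\<^sup>+v. indicator A (u, v + a * u) \<partial>lborel \<partial>lborel)"
    by (subst lborel.nn_integral_fst[symmetric]) auto
  also have "\<dots> = (\<integral>\<^sup>+u. \<integral>\<^sup>+v. indicator A (u, v) \<partial>lborel \<partial>lborel)"
  proof (rule nn_integral_cong)
    fix u
    show "(\<integral>\<^sup>+v. indicator A (u, v + a * u) \<partial>lborel) = (\<integral>\<^sup>+v. indicator A (u, v) \<partial>lborel)"
      using nn_integral_real_affine[of "\<lambda>v. indicator A (u, v)" 1 "a * u"] by (simp add: add.commute)
  qed
  also have "\<dots> = (\<integral>\<^sup>+p. indicator A p \<partial>(lborel \<Otimes>\<^sub>M lborel))"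
    by (subst lborel.nn_integral_fst[symmetric]) auto
  also have "\<dots> = emeasure lborel A"
    unfolding lborel_prod by simp
  finally show "emeasure (distr lborel borel (\<lambda>p. (fst p, snd p + a * fst p))) A = emeasure lborel A" .
qed simp

lemma integral_lborel_distr:
  fixes f :: "real \<times> real \<Rightarrow> complex"
  assumes "distr lborel borel T = lborel" "T \<in> borel_measurable borel" "f \<in> borel_measurable borel"
  shows "(LBINT p. f (T p)) = (LBINT p. f p)"
proof -
  have "(LBINT p. f p) = integral\<^sup>L (distr lborel borel T) f"
    by (simp add: assms(1))
  also have "\<dots> = (LBINT p. f (T p))"
    using assms(2,3) by (subst integral_distr) auto
  finally show ?thesis by simp
qed

definition cplx :: "real \<times> real \<Rightarrow> complex" where
  "cplx p = of_real (fst p) + \<i> * of_real (snd p)"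

lemma cplx_measurable [measurable]: "cplx \<in> borel_measurable borel"
  unfolding cplx_def by (intro borel_measurable_continuous_onI continuous_intros)

lemma cplx_sel [simp]: "Re (cplx p) = fst p" "Im (cplx p) = snd p"
  by (simp_all add: cplx_def)

text \<open>The outer shears have coefficient - s / (1 + c), minus the tangent of half the angle;
  the half turn c = -1 is excluded because that tangent is infinite.\<close>

lemma integral_rotate_aux:
  fixes f :: "complex \<Rightarrow> complex"
  assumes f: "f \<in> borel_measurable borel" and cs: "c\<^sup>2 + s\<^sup>2 = 1" and c1: "1 + c \<noteq> 0"
  shows "(LBINT p. f (Complex c s * cplx p)) = (LBINT p. f (cplx p))"
proof -
  \<comment> \<open>A rotation by an angle other than \<open>pi\<close> is a product of three shears.\<close>
  define a where "a = - s / (1 + c)"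
  have a: "1 + a * s = c" "2 * a + a * a * s = - s"
  proof -
    have "s * s = (1 - c) * (1 + c)" using cs by (simp add: power2_eq_square algebra_simps)
    hence "a * s = - (1 - c)" using c1 by (simp add: a_def)
    thus 1: "1 + a * s = c" by simp
    have "a * (1 + c) = - s" using c1 by (simp add: a_def)
    moreover have "2 * a + a * a * s = a * (1 + (1 + a * s))" by (simp add: algebra_simps)
    ultimately show "2 * a + a * a * s = - s" by (simp only: 1)
  qed
  define T1 where "T1 = (\<lambda>p::real\<times>real. (fst p + a * snd p, snd p))"
  define T2 where "T2 = (\<lambda>p::real\<times>real. (fst p, snd p + s * fst p))"
  have [measurable]: "T1 \<in> borel_measurable borel" "T2 \<in> borel_measurable borel"
    unfolding T1_def T2_def by (intro borel_measurable_continuous_onI continuous_intros)+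
  have d: "distr lborel borel T1 = lborel" "distr lborel borel T2 = lborel"
    unfolding T1_def T2_def by (rule lborel_distr_shear_fst lborel_distr_shear_snd)+
  note [measurable] = f
  have "cplx (T1 (T2 (T1 p))) = Complex c s * cplx p" for p
  proof -
    have "fst p + a * snd p + a * (snd p + s * (fst p + a * snd p)) = (1 + a * s) * fst p + (2 * a + a * a * s) * snd p"
      by (simp add: algebra_simps)
    moreover have "snd p + s * (fst p + a * snd p) = s * fst p + (1 + a * s) * snd p"
      by (simp add: algebra_simps)
    ultimately show ?thesis
      unfolding T1_def T2_def a by (simp add: complex_eq_iff)
  qed
  hence "(LBINT p. f (Complex c s * cplx p)) = (LBINT p. f (cplx (T1 (T2 (T1 p)))))"
    by simp
  also have "\<dots> = (LBINT p. f (cplx (T1 (T2 p))))"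
    by (rule integral_lborel_distr[where f = "\<lambda>p. f (cplx (T1 (T2 p)))"])
       (auto simp: d)
  also have "\<dots> = (LBINT p. f (cplx (T1 p)))"
    by (rule integral_lborel_distr[where f = "\<lambda>p. f (cplx (T1 p))"])
       (auto simp: d)
  also have "\<dots> = (LBINT p. f (cplx p))"
    by (rule integral_lborel_distr[where f = "\<lambda>p. f (cplx p)"])
       (auto simp: d)
  finally show ?thesis .
qed

text \<open>The missing half turn is a quarter turn done twice.\<close>

lemma integral_rotate:
  fixes f :: "complex \<Rightarrow> complex"
  assumes f: "f \<in> borel_measurable borel" and cs: "c\<^sup>2 + s\<^sup>2 = 1"
  shows "(LBINT p. f (Complex c s * cplx p)) = (LBINT p. f (cplx p))"
proof (cases "1 + c = 0")
  case True
  hence "c = -1" by simp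
  hence "Complex c s = -1" using cs by (auto simp: complex_eq_iff)
  hence eq: "Complex c s * w = Complex 0 1 * (Complex 0 1 * w)" for w
    by (simp only:) (simp add: complex_eq_iff)
  have "(LBINT p. f (Complex c s * cplx p)) = (LBINT p. f (Complex 0 1 * (Complex 0 1 * cplx p)))"
    by (simp only: eq)
  also have "\<dots> = (LBINT p. f (Complex 0 1 * cplx p))"
    by (rule integral_rotate_aux[where f = "\<lambda>w. f (Complex 0 1 * w)"]) (use f in \<open>auto intro: measurable_compose[OF _ f]\<close>)
  also have "\<dots> = (LBINT p. f (cplx p))"
    by (rule integral_rotate_aux[OF f]) auto
  finally show ?thesis .
qed (rule integral_rotate_aux[OF f cs])

lemma integrable_gaussian2:
  assumes "p > 0" "q > 0"
  shows "integrable lborel (\<lambda>x::real\<times>real. exp (- p * (fst x)\<^sup>2) * exp (- q * (snd x)\<^sup>2))"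
  using integrable_lborel_product(1)[of "\<lambda>x. exp (- p * x\<^sup>2)" "\<lambda>x. exp (- q * x\<^sup>2)"]
    integrable_gaussian[of p 0] integrable_gaussian[of q 0] assms by simp

lemma gaussian_plane_integral:
  "(LBINT p. exp (- of_real pi * of_real ((cmod (cplx p))\<^sup>2)) :: complex) = 1"
proof -
  define \<sigma> where "\<sigma> = 1 / sqrt (2 * pi)"
  have \<sigma>: "\<sigma> > 0" "\<sigma>\<^sup>2 = 1 / (2 * pi)"
    by (auto simp: \<sigma>_def power_divide)
  have g: "exp (- pi * x\<^sup>2) = normal_density 0 \<sigma> x" for x
    unfolding normal_density_def \<sigma>(2) by (simp add: field_simps)
  have 1: "(LBINT p::real\<times>real. exp (- pi * (fst p)\<^sup>2) * exp (- pi * (snd p)\<^sup>2)) = 1"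
    unfolding g by (subst integrable_lborel_product(2)) (auto simp: \<sigma>(1))
  have eq: "exp (- of_real pi * of_real ((cmod (cplx p))\<^sup>2)) = complex_of_real (exp (- pi * (fst p)\<^sup>2) * exp (- pi * (snd p)\<^sup>2))" for p
    unfolding exp_add[symmetric] exp_of_real[symmetric] cmod_power2 by (simp add: algebra_simps)
  show ?thesis
    unfolding eq integral_complex_of_real 1 by simp
qed

text \<open>Cauchy's formula at the centre of the unit circle for the function taking u to G (u w).
  The indicator writes the average as a Lebesgue integral over the whole line, ready for
  Fubini.\<close>

lemma circle_mean_value:
  assumes "G holomorphic_on UNIV"
  shows "(LBINT t. indicator {0..1} t *\<^sub>R G (cis (2 * pi * t) * w)) = G 0"
proof -
  define g where "g = (\<lambda>\<zeta>. G (\<zeta> * w))"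
  have hol: "g holomorphic_on UNIV"
  proof -
    have "(G \<circ> (\<lambda>\<zeta>. \<zeta> * w)) holomorphic_on UNIV"
      by (rule holomorphic_on_compose) (auto intro!: holomorphic_intros intro: holomorphic_on_subset[OF assms])
    thus ?thesis
      by (simp add: g_def o_def)
  qed
  have "((\<lambda>u. g u / (u - 0)) has_contour_integral (2 * of_real pi * \<i> * g 0)) (circlepath 0 1)"
    by (rule Cauchy_integral_circlepath)
       (auto intro: holomorphic_on_subset[OF hol] holomorphic_on_imp_continuous_on)
  hence "((\<lambda>t. g (circlepath 0 1 t) / circlepath 0 1 t * vector_derivative (circlepath 0 1) (at t within {0..1}))
      has_integral (2 * of_real pi * \<i> * g 0)) {0..1}"
    by (simp add: has_contour_integral_def)
  moreover have "g (circlepath 0 1 t) / circlepath 0 1 t * vector_derivative (circlepath 0 1) (at t within {0..1}) =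
      2 * of_real pi * \<i> * g (cis (2 * pi * t))" if "t \<in> {0..1}" for t
  proof -
    have c: "circlepath 0 1 t = cis (2 * pi * t)"
      by (simp add: circlepath cis_conv_exp mult_ac)
    have "exp (2 * of_real pi * \<i> * of_real t) = cis (2 * pi * t)"
      by (simp add: cis_conv_exp mult_ac)
    hence "vector_derivative (circlepath 0 1) (at t within {0..1}) = 2 * of_real pi * \<i> * cis (2 * pi * t)"
      using vector_derivative_circlepath01[of t 0 1] that by simp
    thus ?thesis
      unfolding c by simp
  qed
  ultimately have "((\<lambda>t. 2 * of_real pi * \<i> * g (cis (2 * pi * t))) has_integral (2 * of_real pi * \<i> * g 0)) {0..1}"
    by (rule has_integral_eq[rotated])
  hence "((\<lambda>t. (1 / (2 * of_real pi * \<i>)) * (2 * of_real pi * \<i> * g (cis (2 * pi * t)))) has_integral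
     (1 / (2 * of_real pi * \<i>)) * (2 * of_real pi * \<i> * g 0)) {0..1}"
    by (rule has_integral_mult_right)
  hence "((\<lambda>t. g (cis (2 * pi * t))) has_integral g 0) {0..1}"
    by simp
  moreover have "set_integrable lborel {0..1} (\<lambda>t. g (cis (2 * pi * t)))"
    by (intro borel_integrable_atLeastAtMost' continuous_on_compose2[OF holomorphic_on_imp_continuous_on[OF hol]] continuous_intros) auto
  ultimately have "(LINT t:{0..1}|lborel. g (cis (2 * pi * t))) = g 0"
    by (metis set_borel_integral_eq_integral(2) integral_unique)
  thus ?thesis
    by (simp add: set_lebesgue_integral_def g_def)
qed

lemma entire_measurable:
  assumes "G holomorphic_on UNIV"
  shows "G \<in> borel_measurable borel"
  using holomorphic_on_imp_continuous_on[OF assms] by (rule borel_measurable_continuous_onI)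

text \<open>Both the Gaussian weight and Lebesgue measure are rotation invariant, so the integral
  equals its average over all rotations. After Fubini the inner average is G 0 by the mean value
  property and the weight has total mass 1. No polar coordinates are needed; \<open>\<kappa>\<close>
  < 1 gives absolute integrability.\<close>

lemma radial_mean_value:
  assumes G: "G holomorphic_on UNIV" and bd: "\<And>w. cmod (G w) \<le> C * exp (pi * \<kappa> * (cmod w)\<^sup>2)" and \<kappa>: "\<kappa> < 1"
  shows "(LBINT p. G (cplx p) * exp (- of_real pi * of_real ((cmod (cplx p))\<^sup>2))) = G 0"
proof -
  note [measurable] = entire_measurable[OF G]
  define E where "E = (\<lambda>w. exp (- of_real pi * of_real ((cmod w)\<^sup>2)) :: complex)"
  have [measurable]: "E \<in> borel_measurable borel"
    unfolding E_def by measurable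
  define I where "I = (LBINT p. G (cplx p) * E (cplx p))"
  define f where "f = (\<lambda>(t::real) (p::real\<times>real). indicator {0..1} t *\<^sub>R (G (cis (2 * pi * t) * cplx p) * E (cplx p)))"
  have rot: "(LBINT p. G (cis t * cplx p) * E (cplx p)) = I" for t
  proof -
    have "(LBINT p. G (cis t * cplx p) * E (cplx p)) = (LBINT p. (\<lambda>w. G w * E w) (Complex (cos t) (sin t) * cplx p))"
      by (intro Bochner_Integration.integral_cong refl) (simp add: E_def norm_mult flip: cis.code)
    also have "\<dots> = I"
      unfolding I_def by (rule integral_rotate) auto
    finally show ?thesis .
  qed
  have "integrable (lborel :: (real \<times> (real \<times> real)) measure) (\<lambda>q. f (fst q) (snd q))"
  proof (rule Bochner_Integration.integrable_bound)
    show "integrable (lborel :: (real \<times> (real \<times> real)) measure) (\<lambda>q. indicator {0..1} (fst q) *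
        (C * (exp (- (pi * (1 - \<kappa>)) * (fst (snd q))\<^sup>2) * exp (- (pi * (1 - \<kappa>)) * (snd (snd q))\<^sup>2))))"
    proof (rule integrable_lborel_product(1))
      show "integrable lborel (\<lambda>p. C * (exp (- (pi * (1 - \<kappa>)) * (fst p)\<^sup>2) * exp (- (pi * (1 - \<kappa>)) * (snd p)\<^sup>2)))"
        using \<kappa> by (intro integrable_mult_right integrable_gaussian2) auto
    qed simp
    have "norm (f t p) \<le> indicator {0..1} t * (C * (exp (- (pi * (1 - \<kappa>)) * (fst p)\<^sup>2) * exp (- (pi * (1 - \<kappa>)) * (snd p)\<^sup>2)))" for t p
    proof -
      have "cmod (G (cis (2 * pi * t) * cplx p)) * cmod (E (cplx p)) \<le> C * exp (pi * \<kappa> * (cmod (cplx p))\<^sup>2) * exp (- pi * (cmod (cplx p))\<^sup>2)"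
        using bd[of "cis (2 * pi * t) * cplx p"] unfolding E_def norm_exp_eq_Re
        by (intro mult_mono) (auto simp: norm_mult order_trans[OF norm_ge_zero])
      also have "\<dots> = C * (exp (- (pi * (1 - \<kappa>)) * (fst p)\<^sup>2) * exp (- (pi * (1 - \<kappa>)) * (snd p)\<^sup>2))"
        unfolding mult.assoc exp_add[symmetric] cmod_power2 by (simp add: algebra_simps)
      finally show ?thesis
        by (auto simp: f_def norm_mult indicator_def)
    qed
    from order_trans[OF this abs_ge_self]
    show "AE q in lborel. norm (f (fst q) (snd q)) \<le> norm (indicator {0..1} (fst q) *
        (C * (exp (- (pi * (1 - \<kappa>)) * (fst (snd q))\<^sup>2) * exp (- (pi * (1 - \<kappa>)) * (snd (snd q))\<^sup>2))))"
      by (intro AE_I2) simp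
    show "(\<lambda>q. f (fst q) (snd q)) \<in> borel_measurable lborel"
    proof -
      have [measurable]: "(\<lambda>q::real \<times> (real \<times> real). cis (2 * pi * fst q)) \<in> borel_measurable borel"
        unfolding cis_conv_exp by (intro borel_measurable_continuous_onI continuous_intros)
      show ?thesis
        unfolding f_def by measurable
    qed
  qed
  hence "(LBINT t. LBINT p. f t p) = (LBINT p. LBINT t. f t p)"
    by (rule Fubini_lborel)
  moreover have "(LBINT t. LBINT p. f t p) = I"
  proof -
    have "(LBINT p. f t p) = indicator {0..1} t *\<^sub>R I" for t
      unfolding f_def by (simp add: rot)
    thus ?thesis by simp
  qed
  moreover have "(LBINT t. f t p) = G 0 * E (cplx p)" for p
  proof -
    have "(LBINT t. f t p) = (LBINT t. (indicator {0..1} t *\<^sub>R G (cis (2 * pi * t) * cplx p)) * E (cplx p))"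
      unfolding f_def by simp
    thus ?thesis
      using circle_mean_value[OF G, of "cplx p"] by (simp only: integral_mult_left_zero)
  qed
  moreover have "(LBINT p. G 0 * E (cplx p)) = G 0"
    using gaussian_plane_integral by (simp add: E_def)
  ultimately have "I = G 0" by simp
  thus ?thesis
    unfolding I_def E_def .
qed

subsection \<open>Surjectivity of the Bargmann transform onto functions of small type\<close>

text \<open>Translating by z turns the exponent into - pi |w|^2 - pi * cnj z * w. The second term is
  holomorphic in w, so the mean value property applies to F (z + w) exp (- pi * cnj z * w), whose
  value at w = 0 is F z.\<close>

lemma reproducing_kernel:
  assumes F: "F holomorphic_on UNIV" and bd: "\<And>w. cmod (F w) \<le> C * exp (pi * \<kappa> * (cmod w)\<^sup>2)" and \<kappa>: "\<kappa> < 1 / 2"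
  shows "(LBINT p. F (cplx p) * exp (- of_real pi * of_real ((cmod (cplx p))\<^sup>2) + of_real pi * cnj (cplx p) * z)) = F z"
proof -
  note [measurable] = entire_measurable[OF F]
  define H where "H = (\<lambda>w. F w * exp (- of_real pi * of_real ((cmod w)\<^sup>2) + of_real pi * cnj w * z))"
  have Hm [measurable]: "H \<in> borel_measurable borel"
  proof -
    have "continuous_on UNIV H"
      unfolding H_def using holomorphic_on_imp_continuous_on[OF F] by (intro continuous_intros) auto
    thus ?thesis by (rule borel_measurable_continuous_onI)
  qed
  define G where "G = (\<lambda>w. F (z + w) * exp (- of_real pi * cnj z * w))"
  have C: "C \<ge> 0"
    using order_trans[OF norm_ge_zero bd[of 0]] by simp
  have "(LBINT p. H (cplx p)) = (LBINT p. H (cplx ((Re z, Im z) + p)))"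
    by (rule integral_lborel_distr[where f = "\<lambda>p. H (cplx p)", symmetric])
       (auto simp: lborel_distr_plus)
  also have "\<dots> = (LBINT p. G (cplx p) * exp (- of_real pi * of_real ((cmod (cplx p))\<^sup>2)))"
  proof (intro Bochner_Integration.integral_cong refl)
    fix p :: "real \<times> real"
    define w where "w = cplx p"
    have shift: "cplx ((Re z, Im z) + p) = z + w"
      by (simp add: complex_eq_iff w_def)
    have "- of_real pi * of_real ((cmod (z + w))\<^sup>2) + of_real pi * cnj (z + w) * z =
        - of_real pi * cnj z * w + - of_real pi * of_real ((cmod w)\<^sup>2)"
      unfolding complex_norm_square by (simp add: algebra_simps)
    thus "H (cplx ((Re z, Im z) + p)) = G (cplx p) * exp (- of_real pi * of_real ((cmod (cplx p))\<^sup>2))"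
      unfolding shift w_def[symmetric] H_def G_def by (simp only: exp_add mult.assoc)
  qed
  also have "\<dots> = G 0"
  proof (rule radial_mean_value)
    have "(F \<circ> (\<lambda>w. z + w)) holomorphic_on UNIV"
      by (rule holomorphic_on_compose) (auto intro!: holomorphic_intros intro: holomorphic_on_subset[OF F])
    hence "(\<lambda>w. F (z + w)) holomorphic_on UNIV"
      by (simp add: o_def)
    thus "G holomorphic_on UNIV"
      unfolding G_def by (intro holomorphic_intros)
    \<comment> \<open>The square of 2 |z| - |w| / 2 yields 2 |z| |w| <= 4 |z|^2 + |w|^2 / 4. This
      keeps the coefficient of |w|^2 at 1/2 + 1/4 = 3/4, below the required 1; the remaining terms
      depend on z alone.\<close>
    show "cmod (G w) \<le> (C * exp (pi * (9 / 2 * (cmod z)\<^sup>2))) * exp (pi * (3 / 4) * (cmod w)\<^sup>2)" for w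
    proof -
      have "\<kappa> * (cmod (z + w))\<^sup>2 \<le> 1 / 2 * (cmod (z + w))\<^sup>2"
        using \<kappa> by (intro mult_right_mono) auto
      also have "\<dots> \<le> 1 / 2 * (cmod z + cmod w)\<^sup>2"
        by (intro mult_left_mono power_mono norm_triangle_ineq) auto
      finally have 1: "\<kappa> * (cmod (z + w))\<^sup>2 \<le> 1 / 2 * (cmod z + cmod w)\<^sup>2" .
      have "Re (- (cnj z * w)) \<le> cmod (- (cnj z * w))"
        by (rule complex_Re_le_cmod)
      hence 2: "- Re (cnj z * w) \<le> cmod z * cmod w"
        by (simp add: norm_mult)
      have "0 \<le> (2 * cmod z - cmod w / 2)\<^sup>2"
        by simp
      hence 3: "1 / 2 * (cmod z + cmod w)\<^sup>2 + cmod z * cmod w \<le> 9 / 2 * (cmod z)\<^sup>2 + 3 / 4 * (cmod w)\<^sup>2"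
        by (simp add: power2_eq_square algebra_simps)
      have "pi * (\<kappa> * (cmod (z + w))\<^sup>2 + - Re (cnj z * w)) \<le> pi * (9 / 2 * (cmod z)\<^sup>2 + 3 / 4 * (cmod w)\<^sup>2)"
        using 1 2 3 by (intro mult_left_mono) (linarith, simp)
      moreover have "cmod (G w) \<le> C * exp (pi * \<kappa> * (cmod (z + w))\<^sup>2) * exp (Re (- of_real pi * cnj z * w))"
        unfolding G_def norm_mult[of "F _"] norm_exp_eq_Re by (intro mult_right_mono bd) auto
      moreover have "C * exp (pi * \<kappa> * (cmod (z + w))\<^sup>2) * exp (Re (- of_real pi * cnj z * w)) =
          C * exp (pi * (\<kappa> * (cmod (z + w))\<^sup>2 + - Re (cnj z * w)))"
        unfolding mult.assoc exp_add[symmetric] by (simp add: algebra_simps)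
      moreover have "C * exp (pi * (9 / 2 * (cmod z)\<^sup>2 + 3 / 4 * (cmod w)\<^sup>2)) =
          (C * exp (pi * (9 / 2 * (cmod z)\<^sup>2))) * exp (pi * (3 / 4) * (cmod w)\<^sup>2)"
        unfolding mult.assoc exp_add[symmetric] by (simp add: algebra_simps)
      ultimately show ?thesis
        using C by (smt (verit) exp_le_cancel_iff mult_left_mono)
    qed
  qed simp
  finally show ?thesis
    unfolding H_def by (simp add: G_def)
qed

text \<open>Applying the adjoint of the transform to \<open>F\<close> gives the preimage. Type
  strictly below pi / 2 bounds the adjoint kernel times \<open>F\<close> by a product of Gaussians,
  so the preimage itself has Gaussian decay. Fubini then turns its transform into the reproducing
  integral of \<open>F\<close>.\<close>

lemma bargmann_surjective:
  assumes F: "F holomorphic_on UNIV" and bd: "\<And>w. cmod (F w) \<le> C * exp (pi * \<kappa> * (cmod w)\<^sup>2)" and \<kappa>: "\<kappa> < 1 / 2"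
  shows "\<exists>f. square_integrable f \<and> (\<forall>z. bargmann f z = F z)"
proof -
  have Fcont: "continuous_on UNIV F"
    using F by (rule holomorphic_on_imp_continuous_on)
  have C: "C \<ge> 0"
    using order_trans[OF norm_ge_zero bd[of 0]] by simp
  \<comment> \<open>With u + i v the plane variable, the exponent divided by pi is - (1 + \<delta>)
    u^2 - \<delta> v^2 + 2 u x - x^2. Splitting 2 u x <= b u^2 + x^2 / b with b = 1 + \<delta> / 2
    spends half of the margin in u^2, and b > 1 leaves the margin \<epsilon> in x^2.\<close>
  define \<delta> where "\<delta> = 1 / 2 - \<kappa>"
  define b where "b = 1 + \<delta> / 2"
  define \<epsilon> where "\<epsilon> = 1 - 1 / b"
  have pos: "\<delta> > 0" "b > 1" "\<epsilon> > 0"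
  proof -
    show "\<delta> > 0" using \<kappa> by (simp add: \<delta>_def)
    thus "b > 1" by (simp add: b_def)
    thus "\<epsilon> > 0" by (simp add: \<epsilon>_def)
  qed
  have \<kappa>_eq: "\<kappa> = 1 / 2 - \<delta>"
    by (simp add: \<delta>_def)
  \<comment> \<open>\<open>sqrt 2\<close> times the integral of \<open>K\<close> over the plane is the adjoint of the Bargmann transform.\<close>
  define K where "K = (\<lambda>x p. F (cplx p) * exp (- of_real pi * of_real ((cmod (cplx p))\<^sup>2) - of_real pi * (of_real x)\<^sup>2
      + 2 * of_real pi * cnj (cplx p) * of_real x - of_real pi * (cnj (cplx p))\<^sup>2 / 2))"
  define J where "J = (\<lambda>p::real\<times>real. exp (- (pi * (\<delta> / 2)) * (fst p)\<^sup>2) * exp (- (pi * \<delta>) * (snd p)\<^sup>2))"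
  have J: "integrable lborel J"
    unfolding J_def using pos by (intro integrable_gaussian2) auto
  have J0: "J p \<ge> 0" for p
    by (simp add: J_def)
  have K: "cmod (K x p) \<le> C * exp (- (pi * \<epsilon>) * x\<^sup>2) * J p" for x p
  proof -
    define u v where "u = fst p" and "v = snd p"
    have "0 \<le> (b * u - x)\<^sup>2 / b"
      using pos by simp
    also have "\<dots> = b * u\<^sup>2 - 2 * u * x + x\<^sup>2 / b"
      using pos by (simp add: power2_eq_square field_simps)
    also have "x\<^sup>2 / b = x\<^sup>2 - \<epsilon> * x\<^sup>2"
      by (simp add: \<epsilon>_def algebra_simps)
    also have "b * u\<^sup>2 = u\<^sup>2 + \<delta> * u\<^sup>2 / 2"
      by (simp add: b_def algebra_simps)
    finally have "\<kappa> * (u\<^sup>2 + v\<^sup>2) - (u\<^sup>2 + v\<^sup>2) - x\<^sup>2 + 2 * u * x - (u\<^sup>2 - v\<^sup>2) / 2 \<le>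
        - \<epsilon> * x\<^sup>2 + (- (\<delta> / 2) * u\<^sup>2 + - \<delta> * v\<^sup>2)"
      unfolding \<kappa>_eq by (simp add: field_simps)
    hence "pi * (\<kappa> * (u\<^sup>2 + v\<^sup>2) - (u\<^sup>2 + v\<^sup>2) - x\<^sup>2 + 2 * u * x - (u\<^sup>2 - v\<^sup>2) / 2) \<le>
        pi * (- \<epsilon> * x\<^sup>2 + (- (\<delta> / 2) * u\<^sup>2 + - \<delta> * v\<^sup>2))"
      by (rule mult_left_mono) simp
    hence "exp (pi * (\<kappa> * (u\<^sup>2 + v\<^sup>2) - (u\<^sup>2 + v\<^sup>2) - x\<^sup>2 + 2 * u * x - (u\<^sup>2 - v\<^sup>2) / 2)) \<le>
        exp (pi * (- \<epsilon> * x\<^sup>2 + (- (\<delta> / 2) * u\<^sup>2 + - \<delta> * v\<^sup>2)))"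
      by simp
    hence "C * exp (pi * (\<kappa> * (u\<^sup>2 + v\<^sup>2) - (u\<^sup>2 + v\<^sup>2) - x\<^sup>2 + 2 * u * x - (u\<^sup>2 - v\<^sup>2) / 2)) \<le>
        C * exp (pi * (- \<epsilon> * x\<^sup>2 + (- (\<delta> / 2) * u\<^sup>2 + - \<delta> * v\<^sup>2)))"
      using C by (rule mult_left_mono)
    also have "\<dots> = C * exp (- (pi * \<epsilon>) * x\<^sup>2) * J p"
      unfolding J_def mult.assoc exp_add[symmetric] u_def v_def by (simp add: algebra_simps)
    finally have 1: "C * exp (pi * (\<kappa> * (u\<^sup>2 + v\<^sup>2) - (u\<^sup>2 + v\<^sup>2) - x\<^sup>2 + 2 * u * x - (u\<^sup>2 - v\<^sup>2) / 2)) \<le>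
        C * exp (- (pi * \<epsilon>) * x\<^sup>2) * J p" .
    define R where "R = Re (- of_real pi * of_real ((cmod (cplx p))\<^sup>2) - of_real pi * (of_real x)\<^sup>2
      + 2 * of_real pi * cnj (cplx p) * of_real x - of_real pi * (cnj (cplx p))\<^sup>2 / 2)"
    have R: "R = pi * (- (u\<^sup>2 + v\<^sup>2) - x\<^sup>2 + 2 * u * x - (u\<^sup>2 - v\<^sup>2) / 2)"
      unfolding R_def cmod_power2 u_def v_def by (simp add: power2_eq_square field_simps)
    have "cmod (K x p) \<le> C * exp (pi * \<kappa> * (cmod (cplx p))\<^sup>2) * exp R"
      unfolding K_def norm_mult[of "F _"] norm_exp_eq_Re R_def by (intro mult_right_mono bd) auto
    also have "\<dots> = C * exp (pi * (\<kappa> * (u\<^sup>2 + v\<^sup>2) - (u\<^sup>2 + v\<^sup>2) - x\<^sup>2 + 2 * u * x - (u\<^sup>2 - v\<^sup>2) / 2))"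
      unfolding R mult.assoc exp_add[symmetric] cmod_power2 u_def v_def by (simp add: algebra_simps)
    finally show ?thesis using 1 by linarith
  qed
  have Kcont: "continuous_on UNIV (\<lambda>q. K (fst q) (snd q))"
    unfolding K_def cplx_def by (intro continuous_intros continuous_on_compose2[OF Fcont]) auto
  have Kmeas [measurable]: "(\<lambda>q. K (fst q) (snd q)) \<in> borel_measurable borel"
    by (rule borel_measurable_continuous_onI[OF Kcont])
  have Kmeas2 [measurable]: "K x \<in> borel_measurable borel" for x
  proof -
    have "continuous_on UNIV (K x)"
      unfolding K_def cplx_def by (intro continuous_intros continuous_on_compose2[OF Fcont]) auto
    thus ?thesis by (rule borel_measurable_continuous_onI)
  qed
  have Kint: "integrable lborel (K x)" for x
  proof (rule Bochner_Integration.integrable_bound)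
    show "integrable lborel (\<lambda>p. C * exp (- (pi * \<epsilon>) * x\<^sup>2) * J p)"
      by (intro integrable_mult_right J)
    show "AE p in lborel. norm (K x p) \<le> norm (C * exp (- (pi * \<epsilon>) * x\<^sup>2) * J p)"
      using order_trans[OF K abs_ge_self] by (intro AE_I2) simp
  qed simp
  define f where "f = (\<lambda>x. of_real (sqrt 2) * (LBINT p. K x p))"
  have fmeas [measurable]: "f \<in> borel_measurable borel"
  proof -
    have "(\<lambda>(x, p). K x p) \<in> borel_measurable (lborel \<Otimes>\<^sub>M lborel)"
      using Kmeas unfolding case_prod_beta' lborel_prod by simp
    hence "(\<lambda>x. LBINT p. K x p) \<in> borel_measurable lborel"
      by (rule lborel.borel_measurable_lebesgue_integral)
    thus ?thesis unfolding f_def by simp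
  qed
  define B where "B = sqrt 2 * (C * (LBINT p. J p))"
  have fbd: "cmod (f x) \<le> B * exp (- (pi * \<epsilon>) * x\<^sup>2)" for x
  proof -
    have "cmod (LBINT p. K x p) \<le> (LBINT p. cmod (K x p))"
      by (rule integral_norm_bound)
    also have "\<dots> \<le> (LBINT p. C * exp (- (pi * \<epsilon>) * x\<^sup>2) * J p)"
      by (intro integral_mono integrable_norm Kint integrable_mult_right J K)
    also have "\<dots> = C * exp (- (pi * \<epsilon>) * x\<^sup>2) * (LBINT p. J p)"
      by simp
    finally have "sqrt 2 * cmod (LBINT p. K x p) \<le> sqrt 2 * (C * exp (- (pi * \<epsilon>) * x\<^sup>2) * (LBINT p. J p))"
      by (rule mult_left_mono) simp
    thus ?thesis
      by (simp add: f_def B_def norm_mult mult_ac)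
  qed
  have sq: "square_integrable f"
    unfolding square_integrable_def
  proof
    show "f \<in> borel_measurable lebesgue"
      by (rule borel_measurable_lebesgue[OF fmeas])
    have "integrable lborel (\<lambda>x. (cmod (f x))\<^sup>2)"
    proof (rule Bochner_Integration.integrable_bound)
      show "integrable lborel (\<lambda>x. B\<^sup>2 * exp (- (2 * pi * \<epsilon>) * x\<^sup>2 + 0 * x))"
        using pos by (intro integrable_mult_right integrable_gaussian) auto
      have "(cmod (f x))\<^sup>2 \<le> B\<^sup>2 * exp (- (2 * pi * \<epsilon>) * x\<^sup>2 + 0 * x)" for x
        using power_mono[OF fbd[of x] norm_ge_zero, of 2] by (simp add: power_mult_distrib exp_double[symmetric] mult_ac)
      thus "AE x in lborel. norm ((cmod (f x))\<^sup>2) \<le> norm (B\<^sup>2 * exp (- (2 * pi * \<epsilon>) * x\<^sup>2 + 0 * x))"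
        by (intro AE_I2) simp
    qed simp
    thus "integrable lebesgue (\<lambda>x. (cmod (f x))\<^sup>2)"
      by (subst integrable_completion) simp_all
  qed
  have "bargmann f z = F z" for z
  proof -
    define E where "E = (\<lambda>x. exp (- of_real pi * (of_real x)\<^sup>2 + 2 * of_real pi * of_real x * z) :: complex)"
    have [measurable]: "E \<in> borel_measurable borel"
      unfolding E_def by measurable
    define k where "k = (\<lambda>x p. of_real (sqrt 2) * K x p * E x)"
    have kint: "integrable (lborel :: (real \<times> (real \<times> real)) measure) (\<lambda>q. k (fst q) (snd q))"
    proof (rule Bochner_Integration.integrable_bound)
      show "integrable (lborel :: (real \<times> (real \<times> real)) measure)
          (\<lambda>q. (sqrt 2 * C * exp (- (pi * (1 + \<epsilon>)) * (fst q)\<^sup>2 + (2 * pi * Re z) * fst q)) * J (snd q))"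
        by (rule integrable_lborel_product(1)[OF integrable_mult_right[OF integrable_gaussian] J]) (use pos in simp)
      have kb: "norm (k x p) \<le> (sqrt 2 * C * exp (- (pi * (1 + \<epsilon>)) * x\<^sup>2 + (2 * pi * Re z) * x)) * J p" for x p
      proof -
        have "norm (k x p) \<le> sqrt 2 * (C * exp (- (pi * \<epsilon>) * x\<^sup>2) * J p) * exp (- pi * x\<^sup>2 + 2 * pi * Re z * x)"
          unfolding k_def norm_mult E_def norm_exp_eq_Re using K[of x p]
          by (intro mult_mono) (auto simp: mult_ac C J0)
        also have "\<dots> = (sqrt 2 * C * exp (- (pi * (1 + \<epsilon>)) * x\<^sup>2 + (2 * pi * Re z) * x)) * J p"
        proof -
          have "exp (- (pi * \<epsilon>) * x\<^sup>2) * exp (- pi * x\<^sup>2 + 2 * pi * Re z * x) = exp (- (pi * (1 + \<epsilon>)) * x\<^sup>2 + (2 * pi * Re z) * x)"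
            unfolding exp_add[symmetric] by (simp add: algebra_simps)
          thus ?thesis by (simp add: mult_ac)
        qed
        finally show ?thesis .
      qed
      show "AE q in lborel. norm (k (fst q) (snd q)) \<le>
          norm ((sqrt 2 * C * exp (- (pi * (1 + \<epsilon>)) * (fst q)\<^sup>2 + (2 * pi * Re z) * fst q)) * J (snd q))"
        unfolding real_norm_def by (intro AE_I2 order_trans[OF kb abs_ge_self])
      show "(\<lambda>q. k (fst q) (snd q)) \<in> borel_measurable lborel"
        unfolding k_def by measurable
    qed
    \<comment> \<open>Writing w for the conjugate plane variable, the Gaussian integral contributes
      exp (pi (w + z)^2 / 2). Its two squares cancel against the prefactors of the transform and of
      its adjoint, and the cross term pi w z is the reproducing kernel.\<close>
    have inner: "exp (- of_real pi * z\<^sup>2 / 2) * (LBINT x. k x p) =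
        F (cplx p) * exp (- of_real pi * of_real ((cmod (cplx p))\<^sup>2) + of_real pi * cnj (cplx p) * z)" for p
    proof -
      define w where "w = cnj (cplx p)"
      define A where "A = - of_real pi * of_real ((cmod (cplx p))\<^sup>2) - of_real pi * w\<^sup>2 / 2"
      define c where "c = 2 * of_real pi * w + 2 * of_real pi * z"
      have "k x p = (of_real (sqrt 2) * F (cplx p) * exp A) * exp (- 2 * of_real pi * (of_real x)\<^sup>2 + c * of_real x)" for x
      proof -
        have "k x p = of_real (sqrt 2) * F (cplx p) * (exp (- of_real pi * of_real ((cmod (cplx p))\<^sup>2) - of_real pi * (of_real x)\<^sup>2
            + 2 * of_real pi * w * of_real x - of_real pi * w\<^sup>2 / 2) * E x)"
          unfolding k_def K_def w_def by (simp only: mult.assoc)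
        also have "exp (- of_real pi * of_real ((cmod (cplx p))\<^sup>2) - of_real pi * (of_real x)\<^sup>2
            + 2 * of_real pi * w * of_real x - of_real pi * w\<^sup>2 / 2) * E x = exp A * exp (- 2 * of_real pi * (of_real x)\<^sup>2 + c * of_real x)"
          unfolding E_def exp_add[symmetric] A_def c_def by (rule arg_cong[where f = exp]) (simp add: algebra_simps)
        finally show ?thesis by (simp only: mult.assoc)
      qed
      hence "(LBINT x. k x p) = (of_real (sqrt 2) * F (cplx p) * exp A) * (exp (c\<^sup>2 / (8 * of_real pi)) / of_real (sqrt 2))"
        by (simp only: integral_mult_right_zero gaussian_integral)
      hence "exp (- of_real pi * z\<^sup>2 / 2) * (LBINT x. k x p) = F (cplx p) * (exp (- of_real pi * z\<^sup>2 / 2) * exp A * exp (c\<^sup>2 / (8 * of_real pi)))"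
        by simp
      also have "exp (- of_real pi * z\<^sup>2 / 2) * exp A * exp (c\<^sup>2 / (8 * of_real pi)) =
          exp (- of_real pi * of_real ((cmod (cplx p))\<^sup>2) + of_real pi * w * z)"
        unfolding exp_add[symmetric] A_def c_def by (rule arg_cong[where f = exp]) (simp add: power2_eq_square field_simps)
      finally show ?thesis
        unfolding w_def .
    qed
    have "bargmann f z = exp (- of_real pi * z\<^sup>2 / 2) * (LBINT x. f x * E x)"
      unfolding bargmann_def E_def by (subst integral_completion) auto
    also have "(LBINT x. f x * E x) = (LBINT x. LBINT p. k x p)"
      unfolding f_def k_def by (intro Bochner_Integration.integral_cong refl) simp
    also have "\<dots> = (LBINT p. LBINT x. k x p)"
      by (rule Fubini_lborel[OF kint])
    also have "exp (- of_real pi * z\<^sup>2 / 2) * \<dots> = (LBINT p. exp (- of_real pi * z\<^sup>2 / 2) * (LBINT x. k x p))"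
      by simp
    also have "\<dots> = F z"
      unfolding inner by (rule reproducing_kernel[OF F bd \<kappa>])
    finally show ?thesis .
  qed
  thus ?thesis
    using sq by blast
qed

subsection \<open>Entire functions with prescribed zeros\<close>

text \<open>Euler's product for the sine at i y: pi y times the partial products increases to sinh
  (pi y), and sinh t <= t exp t cancels the factor pi y.\<close>

lemma prod_le_exp:
  assumes "y \<ge> 0"
  shows "(\<Prod>k=1..n. 1 + y\<^sup>2 / (real k)\<^sup>2) \<le> exp (pi * y)"
proof (cases "y = 0")
  case False
  hence y: "y > 0" using assms by simp
  define s where "s = (\<lambda>n. pi * y * (\<Prod>k=1..n. 1 + y\<^sup>2 / (real k)\<^sup>2))"
  have "(\<lambda>n. norm (of_real pi * (\<i> * of_real y) * (\<Prod>k=1..n. 1 - (\<i> * of_real y)\<^sup>2 / of_nat k ^ 2)))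
      \<longlonglongrightarrow> norm (sin (of_real pi * (\<i> * of_real y)))"
    by (intro tendsto_norm sin_product_formula_complex)
  moreover have "norm (of_real pi * (\<i> * of_real y) * (\<Prod>k=1..n. 1 - (\<i> * of_real y)\<^sup>2 / of_nat k ^ 2)) = s n" for n
  proof -
    have "1 - (\<i> * of_real y)\<^sup>2 / of_nat k ^ 2 = complex_of_real (1 + y\<^sup>2 / (real k)\<^sup>2)" for k
      by (simp add: power_mult_distrib)
    hence "(\<Prod>k=1..n. 1 - (\<i> * of_real y)\<^sup>2 / of_nat k ^ 2) = complex_of_real (\<Prod>k=1..n. 1 + y\<^sup>2 / (real k)\<^sup>2)"
      by (simp only: of_real_prod)
    moreover have "(\<Prod>k=1..n. 1 + y\<^sup>2 / (real k)\<^sup>2) \<ge> 0"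
      by (intro prod_nonneg) (auto intro: add_nonneg_nonneg)
    ultimately show ?thesis
      using y by (simp only: norm_mult norm_of_real s_def) simp
  qed
  moreover have "norm (sin (of_real pi * (\<i> * of_real y))) = sinh (pi * y)"
  proof -
    have "sin (of_real pi * (\<i> * of_real y)) = \<i> * of_real (sinh (pi * y))"
    proof -
      have *: "exp (\<i> * (of_real pi * (\<i> * of_real y))) = complex_of_real (exp (- (pi * y)))"
        "exp (- (\<i> * (of_real pi * (\<i> * of_real y)))) = complex_of_real (exp (pi * y))"
        unfolding exp_of_real[symmetric] by (rule arg_cong[where f = exp], simp add: complex_eq_iff)+
      show ?thesis
        unfolding sin_exp_eq * by (simp add: complex_eq_iff sinh_def) (simp add: field_simps)
    qed
    thus ?thesis
      using y by (simp add: norm_mult)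
  qed
  ultimately have "s \<longlonglongrightarrow> sinh (pi * y)"
    by simp
  moreover have "incseq s"
  proof (rule incseq_SucI)
    fix n
    have "(\<Prod>k=1..n. 1 + y\<^sup>2 / (real k)\<^sup>2) * 1 \<le> (\<Prod>k=1..n. 1 + y\<^sup>2 / (real k)\<^sup>2) * (1 + y\<^sup>2 / (real (Suc n))\<^sup>2)"
      by (intro mult_left_mono prod_nonneg) (auto intro: add_nonneg_nonneg)
    thus "s n \<le> s (Suc n)"
      unfolding s_def using y by (intro mult_left_mono) auto
  qed
  ultimately have "s n \<le> sinh (pi * y)"
    by (rule incseq_le[rotated])
  also have "sinh (pi * y) \<le> pi * y * exp (pi * y)"
  proof -
    define t where "t = pi * y"
    have "1 - 2 * t \<le> exp (- (2 * t))"
      using exp_ge_add_one_self[of "- (2 * t)"] by simp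
    hence "(1 - 2 * t) * exp t \<le> exp (- (2 * t)) * exp t"
      by (rule mult_right_mono) simp
    also have "\<dots> = exp (- t)"
      by (simp flip: exp_add)
    finally show ?thesis
      unfolding t_def[symmetric] by (simp add: sinh_def algebra_simps)
  qed
  finally show ?thesis
    using y by (simp add: s_def)
qed simp

text \<open>The comparison sequence is sqrt (q n), for which the product is a sine in z^2 of type pi
  / q. As q < a^2, eventually lam_n^2 >= q n, so all but finitely many factors are dominated by
  those of the comparison product; the exceptions only change the constant.\<close>

lemma quartic_product:
  fixes lam :: "nat \<Rightarrow> real"
  assumes pos: "\<And>n. n \<ge> 1 \<Longrightarrow> lam n > 0"
    and lim: "(\<lambda>n. lam n / sqrt (real n)) \<longlonglongrightarrow> a" and q: "0 < q" "q < a\<^sup>2" and e: "cmod e = 1"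
  shows "\<exists>S C. S holomorphic_on UNIV \<and> S 0 = 1 \<and> (\<forall>z. cmod (S z) \<le> C * exp (pi * (1 / q) * (cmod z)\<^sup>2)) \<and>
           (\<forall>n\<ge>1. S (e * of_real (lam n)) = 0 \<and> S (- (e * of_real (lam n))) = 0)"
proof -
  have e0: "e \<noteq> 0" using e by auto
  define m where "m = (\<lambda>n. lam (Suc n))"
  have m: "m n > 0" for n
    unfolding m_def by (rule pos) simp
  have "(\<lambda>n. (lam n / sqrt (real n))\<^sup>2) \<longlonglongrightarrow> a\<^sup>2"
    by (intro tendsto_power lim)
  hence "\<forall>\<^sub>F n in sequentially. q < (lam n / sqrt (real n))\<^sup>2"
    using q(2) by (rule order_tendstoD(1))
  then obtain n1 where n1: "\<And>n. n \<ge> n1 \<Longrightarrow> q < (lam n / sqrt (real n))\<^sup>2"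
    by (auto simp: eventually_sequentially)
  have lower: "q * real (Suc n) \<le> (m n)\<^sup>2" if "n \<ge> n1" for n
    using n1[of "Suc n"] that by (simp add: m_def power_divide field_simps del: of_nat_Suc)
  define f where "f = (\<lambda>n z. - ((z / (e * of_real (m n))) ^ 4))"
  have nf: "norm (f n z) = (cmod z) ^ 4 / (m n) ^ 4" for n z
    using m[of n] e by (simp add: f_def norm_power norm_divide norm_mult power_divide)
  define P where "P = (\<lambda>N z. \<Prod>n<N. 1 + f n z)"
  have summ: "summable (\<lambda>n. r ^ 4 / (m n) ^ 4)" for r
  proof (rule summable_comparison_test_ev)
    show "\<forall>\<^sub>F n in sequentially. norm (r ^ 4 / (m n) ^ 4) \<le> (r ^ 4 / q\<^sup>2) * (1 / (real (Suc n))\<^sup>2)"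
    proof (rule eventually_sequentiallyI[of n1])
      fix n assume "n \<ge> n1"
      from lower[OF this] have "(q * real (Suc n))\<^sup>2 \<le> ((m n)\<^sup>2)\<^sup>2"
        using q by (intro power_mono) auto
      hence "r ^ 4 / (m n) ^ 4 \<le> r ^ 4 / (q * real (Suc n))\<^sup>2"
        using m[of n] q by (intro divide_left_mono mult_pos_pos) auto
      thus "norm (r ^ 4 / (m n) ^ 4) \<le> (r ^ 4 / q\<^sup>2) * (1 / (real (Suc n))\<^sup>2)"
        by (simp add: power_mult_distrib del: of_nat_Suc)
    qed
    have "summable (\<lambda>n. 1 / (real (Suc n))\<^sup>2)"
      using inverse_power_summable[of 2, where 'a = real]
      by (subst summable_Suc_iff) (simp add: field_simps)
    thus "summable (\<lambda>n. (r ^ 4 / q\<^sup>2) * (1 / (real (Suc n))\<^sup>2))"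
      by (rule summable_mult)
  qed
  have unif: "uniformly_convergent_on (cball 0 r) P" for r
    unfolding P_def
  proof (rule uniformly_convergent_on_prod)
    show "continuous_on (cball 0 r) (f n)" for n
      unfolding f_def using m[of n] e0 by (intro continuous_intros) auto
    show "uniformly_convergent_on (cball 0 r) (\<lambda>N x. \<Sum>n<N. norm (f n x))"
    proof (rule Weierstrass_m_test'[OF _ summ[of r]])
      show "norm (norm (f n x)) \<le> r ^ 4 / m n ^ 4" if "x \<in> cball 0 r" for n x
        using that m[of n] by (simp add: nf divide_right_mono power_mono)
    qed
  qed simp
  define S where "S = (\<lambda>z. lim (\<lambda>N. P N z))"
  have unif_lim: "uniform_limit (cball 0 r) P S sequentially" for r
    using unif[of r] unfolding S_def uniformly_convergent_uniform_limit_iff .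
  have lim: "(\<lambda>N. P N z) \<longlonglongrightarrow> S z" for z
    by (rule tendsto_uniform_limitI[OF unif_lim[of "cmod z"]]) simp
  have hol: "S holomorphic_on UNIV"
  proof (rule holomorphic_uniform_sequence[OF open_UNIV])
    show "P n holomorphic_on UNIV" for n
      unfolding P_def f_def using m e0 by (intro holomorphic_intros) (auto simp: less_imp_neq[symmetric])
    show "\<exists>d>0. cball z d \<subseteq> UNIV \<and> uniform_limit (cball z d) P S sequentially" for z
    proof (intro exI[of _ 1] conjI)
      show "uniform_limit (cball z 1) P S sequentially"
        by (rule uniform_limit_on_subset[OF unif_lim[of "cmod z + 1"]])
           (simp add: cball_subset_cball_iff dist_norm)
    qed auto
  qed
  \<comment> \<open>The excess of the n-th factor over 1 + y^2 / (n + 1)^2 with y = |z|^2 / q. It is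
    1 from \<open>n1\<close> on, so every partial product of these excesses is at most the finite
    product \<open>B\<close>, uniformly in z.\<close>
  define c where "c = (\<lambda>n. max 1 ((q * real (Suc n) / (m n)\<^sup>2)\<^sup>2))"
  define B where "B = (\<Prod>n<n1. c n)"
  have c1: "c n \<ge> 1" for n by (simp add: c_def)
  have c2: "c n = 1" if "n \<ge> n1" for n
  proof -
    have "q * real (Suc n) / (m n)\<^sup>2 \<le> 1"
      using lower[OF that] m[of n] by (simp add: divide_le_eq del: of_nat_Suc)
    hence "(q * real (Suc n) / (m n)\<^sup>2)\<^sup>2 \<le> 1"
      using q by (intro power_le_one) (auto intro!: divide_nonneg_nonneg)
    thus ?thesis by (simp add: c_def)
  qed
  have cB: "(\<Prod>n<N. c n) \<le> B" for N
  proof -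
    have "(\<Prod>n<N. c n) = (\<Prod>n\<in>{..<N} \<inter> {..<n1}. c n)"
      by (intro prod.mono_neutral_right) (auto intro!: c2)
    also have "\<dots> \<le> B"
      unfolding B_def using c1 by (intro prod_mono2) (auto intro: order_trans[OF zero_le_one])
    finally show ?thesis .
  qed
  have bound: "cmod (P N z) \<le> B * exp (pi * (1 / q) * (cmod z)\<^sup>2)" for N z
  proof -
    define y where "y = (cmod z)\<^sup>2 / q"
    have y: "y \<ge> 0" using q by (simp add: y_def)
    have "cmod (P N z) \<le> (\<Prod>n<N. 1 + norm (f n z))"
      unfolding P_def prod_norm[symmetric]
      by (intro prod_mono conjI norm_ge_zero order_trans[OF norm_triangle_ineq]) auto
    also have "\<dots> \<le> (\<Prod>n<N. c n * (1 + y\<^sup>2 / (real (Suc n))\<^sup>2))"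
    proof (intro prod_mono conjI)
      fix n
      show "0 \<le> 1 + norm (f n z)" by simp
      have "norm (f n z) = (q * real (Suc n) / (m n)\<^sup>2)\<^sup>2 * (y\<^sup>2 / (real (Suc n))\<^sup>2)"
        unfolding nf y_def using q m[of n] by (simp add: field_simps del: of_nat_Suc)
      also have "\<dots> \<le> c n * (y\<^sup>2 / (real (Suc n))\<^sup>2)"
        unfolding c_def by (intro mult_right_mono) auto
      finally show "1 + norm (f n z) \<le> c n * (1 + y\<^sup>2 / (real (Suc n))\<^sup>2)"
        using c1[of n] by (simp add: distrib_left)
    qed
    also have "\<dots> = (\<Prod>n<N. c n) * (\<Prod>n<N. 1 + y\<^sup>2 / (real (Suc n))\<^sup>2)"
      by (rule prod.distrib)
    also have "(\<Prod>n<N. 1 + y\<^sup>2 / (real (Suc n))\<^sup>2) = (\<Prod>k=1..N. 1 + y\<^sup>2 / (real k)\<^sup>2)"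
      by (rule prod.reindex_bij_witness[of _ "\<lambda>k. k - 1" Suc]) auto
    also have "(\<Prod>n<N. c n) * \<dots> \<le> B * exp (pi * y)"
      using prod_le_exp[OF y, of N] cB[of N] order_trans[OF zero_le_one c1]
      by (intro mult_mono) (auto intro!: prod_nonneg add_nonneg_nonneg simp: B_def)
    finally show ?thesis
      by (simp add: y_def)
  qed
  have "cmod (S z) \<le> B * exp (pi * (1 / q) * (cmod z)\<^sup>2)" for z
    by (rule tendsto_upperbound[OF tendsto_norm[OF lim] always_eventually]) (use bound in auto)
  moreover have "S 0 = 1"
    using lim[of 0] by (simp add: P_def f_def LIMSEQ_const_iff)
  moreover have "S (e * of_real (lam n)) = 0 \<and> S (- (e * of_real (lam n))) = 0" if "n \<ge> 1" for n
  proof -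
    have *: "S z = 0" if "z = e * of_real (m k) \<or> z = - (e * of_real (m k))" for z k
    proof -
      have "f k z = -1"
        using that m[of k] e0 by (auto simp: f_def)
      hence "P N z = 0" if "N > k" for N
        using that unfolding P_def by (intro prod_zero bexI[of _ k]) auto
      hence "\<forall>\<^sub>F N in sequentially. P N z = 0"
        by (intro eventually_sequentiallyI[of "Suc k"]) simp
      hence "(\<lambda>N. P N z) \<longlonglongrightarrow> 0"
        by (rule tendsto_eventually)
      thus ?thesis
        using lim LIMSEQ_unique by blast
    qed
    have "lam n = m (n - 1)"
      using that by (simp add: m_def)
    thus ?thesis
      using *[of "e * of_real (m (n - 1))" "n - 1"] *[of "- (e * of_real (m (n - 1)))" "n - 1"] by simp
  qed
  ultimately show ?thesis
    using hol by blast
qed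

subsection \<open>Gabor phase retrieval on two lines\<close>

text \<open>Under z = t - i omega the direction with angle x becomes this unit number, so the two
  lines differ by the rotation through the difference of the angles.\<close>

lemma direction_cis: "Complex (sin x) (- cos x) = - \<i> * cis x"
  by (simp add: complex_eq_iff)

lemma norm_gabor_eq_iff:
  "cmod (gabor f1 (t, \<omega>)) = cmod (gabor f2 (t, \<omega>)) \<longleftrightarrow>
   cmod (bargmann f1 (Complex t (- \<omega>))) = cmod (bargmann f2 (Complex t (- \<omega>)))"
  by (simp add: gabor_bargmann norm_mult)

text \<open>The reflections and the rotation need both lines to pass through 0, hence the move to
  the centre. The factor introduced by the move is common to both functions and has no zeros, so
  proportionality passes back to the Bargmann transforms.\<close>

lemma retrieval_of_two_lines:
  fixes lam :: "nat \<Rightarrow> nat \<Rightarrow> real"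
  assumes f: "square_integrable f1" "square_integrable f2"
    and incr: "\<And>l. l \<in> {1, 2} \<Longrightarrow> strict_mono_on {1..} (\<lambda>n. lam n l)"
    and pos: "\<And>l n. l \<in> {1, 2} \<Longrightarrow> n \<ge> 1 \<Longrightarrow> lam n l > 0"
    and lim: "\<And>l. l \<in> {1, 2} \<Longrightarrow> (\<lambda>n. lam n l / sqrt (real n)) \<longlonglongrightarrow> a l"
    and a: "\<And>l. l \<in> {1, 2} \<Longrightarrow> a l < 1"
    and irr: "(\<theta> 1 - \<theta> 2) / pi \<notin> \<rat>"
    and eq: "\<And>l n. l \<in> {1, 2} \<Longrightarrow> n \<ge> 1 \<Longrightarrow>
      cmod (gabor f1 (t0 + lam n l * sin (\<theta> l), \<omega>0 + lam n l * cos (\<theta> l))) =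
      cmod (gabor f2 (t0 + lam n l * sin (\<theta> l), \<omega>0 + lam n l * cos (\<theta> l)))"
  shows "\<exists>\<alpha>::real. AE x in lebesgue. f1 x = exp (\<i> * \<alpha>) * f2 x"
proof -
  define z0 where "z0 = Complex t0 (- \<omega>0)"
  define e where "e = (\<lambda>l. Complex (sin (\<theta> l)) (- cos (\<theta> l)))"
  \<comment> \<open>The Fock space translation to the centre preserves the growth bound \<open>exp (pi / 2 * \<bar>z\<bar>\<^sup>2)\<close>.\<close>
  define B where "B = (\<lambda>f z. bargmann f (z + z0) * exp (- of_real pi * z * cnj z0))"
  have hol: "B f holomorphic_on UNIV" if "square_integrable f" for f
  proof -
    have "(bargmann f \<circ> (\<lambda>z. z + z0)) holomorphic_on UNIV"
      by (rule holomorphic_on_compose)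
         (auto intro!: holomorphic_intros intro: holomorphic_on_subset[OF bargmann_holomorphic[OF that]])
    hence "(\<lambda>z. bargmann f (z + z0)) holomorphic_on UNIV"
      by (simp add: o_def)
    thus ?thesis
      unfolding B_def by (intro holomorphic_intros)
  qed
  have "\<exists>C. \<forall>z. cmod (B f z) \<le> C * exp (pi / 2 * (cmod z)\<^sup>2)" if sq: "square_integrable f" for f
  proof -
    obtain C where C: "\<And>z. cmod (bargmann f z) \<le> C * exp (pi / 2 * (cmod z)\<^sup>2)"
      using bargmann_growth[OF sq] by blast
    have "cmod (B f z) \<le> (C * exp (pi / 2 * (cmod z0)\<^sup>2)) * exp (pi / 2 * (cmod z)\<^sup>2)" for z
    proof -
      have "cmod (B f z) \<le> C * exp (pi / 2 * (cmod (z + z0))\<^sup>2) * exp (Re (- of_real pi * z * cnj z0))"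
        unfolding B_def norm_mult[of "bargmann f _"] norm_exp_eq_Re by (intro mult_right_mono C) auto
      also have "\<dots> = (C * exp (pi / 2 * (cmod z0)\<^sup>2)) * exp (pi / 2 * (cmod z)\<^sup>2)"
        unfolding mult.assoc exp_add[symmetric] cmod_power2 by (simp add: power2_eq_square field_simps)
      finally show ?thesis .
    qed
    thus ?thesis by blast
  qed
  from this[OF f(1)] this[OF f(2)] obtain C1 C2 where
    C: "\<And>z. cmod (B f1 z) \<le> C1 * exp (pi / 2 * (cmod z)\<^sup>2)" "\<And>z. cmod (B f2 z) \<le> C2 * exp (pi / 2 * (cmod z)\<^sup>2)"
    by blast
  have Cmax: "cmod (B f1 z) \<le> max C1 C2 * exp (pi / 2 * (cmod z)\<^sup>2)" "cmod (B f2 z) \<le> max C1 C2 * exp (pi / 2 * (cmod z)\<^sup>2)" for z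
    by (rule order_trans[OF C(1)], simp, rule order_trans[OF C(2)], simp)
  have refl: "B f1 z * cnj (B f1 ((e l)\<^sup>2 * cnj z)) = B f2 z * cnj (B f2 ((e l)\<^sup>2 * cnj z))" if l: "l \<in> {1, 2}" for l z
  proof (rule reflection_identity[OF hol[OF f(1)] hol[OF f(2)] Cmax _ incr[OF l] pos[OF l] lim[OF l] a[OF l]])
    show "cmod (e l) = 1"
      by (simp add: e_def direction_cis norm_mult)
    show "cmod (B f1 (e l * of_real (lam n l))) = cmod (B f2 (e l * of_real (lam n l)))" if "n \<ge> 1" for n
    proof -
      have "e l * of_real (lam n l) + z0 = Complex (t0 + lam n l * sin (\<theta> l)) (- (\<omega>0 + lam n l * cos (\<theta> l)))"
        by (simp add: complex_eq_iff e_def z0_def)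
      thus ?thesis
        using eq[OF l that] unfolding norm_gabor_eq_iff B_def by (simp add: norm_mult)
    qed
  qed
  have "\<exists>c. cmod c = 1 \<and> (\<forall>z. B f1 z = c * B f2 z)"
  proof (rule entire_proportional[OF hol[OF f(1)] hol[OF f(2)]])
    show "cmod (e 1) = 1"
      by (simp add: e_def direction_cis norm_mult)
    show "e 2 = e 1 * cis (\<theta> 2 - \<theta> 1)"
      by (simp add: e_def direction_cis cis_mult)
    show "(\<theta> 2 - \<theta> 1) / pi \<notin> \<rat>"
      using irr Rats_minus_iff[of "(\<theta> 2 - \<theta> 1) / pi"] by (simp add: minus_divide_left)
  qed (use refl in auto)
  then obtain c where c: "cmod c = 1" "\<And>z. B f1 z = c * B f2 z"
    by blast
  have "bargmann f1 z = c * bargmann f2 z" for z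
    using c(2)[of "z - z0"] by (simp add: B_def)
  hence "AE x in lebesgue. f1 x = c * f2 x"
    by (rule bargmann_injective[OF f])
  moreover have "c = exp (\<i> * of_real (Arg c))"
    using c(1) by (metis Arg_eq norm_zero of_real_1 mult_1 zero_neq_one)
  ultimately show ?thesis
    by metis
qed

text \<open>Any increase k of the type absorbs the cross term of the translation: 2 s x y <= k x^2 +
  (s^2 / k) y^2. The rest depends on \<open>z0\<close> only and goes into the constant.\<close>

lemma growth_shift:
  assumes S: "\<And>z. cmod (S z) \<le> C * exp (pi * s * (cmod z)\<^sup>2)" and s: "0 < s" "s < \<kappa>"
  shows "\<exists>C'. \<forall>z. cmod (S (z - z0)) \<le> C' * exp (pi * \<kappa> * (cmod z)\<^sup>2)"
proof (intro exI allI)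
  fix z
  have C: "C \<ge> 0"
    using order_trans[OF norm_ge_zero S[of 0]] by simp
  define x y where "x = cmod z" and "y = cmod z0"
  define k where "k = \<kappa> - s"
  have k: "k > 0" using s by (simp add: k_def)
  have "s * (cmod (z - z0))\<^sup>2 \<le> s * (x + y)\<^sup>2"
    unfolding x_def y_def using s by (intro mult_left_mono power_mono norm_triangle_ineq4) auto
  also have "\<dots> \<le> \<kappa> * x\<^sup>2 + (s + s\<^sup>2 / k) * y\<^sup>2"
  proof -
    have "0 \<le> (k * x - s * y)\<^sup>2 / k"
      using k by simp
    also have "\<dots> = k * x\<^sup>2 - 2 * s * x * y + s\<^sup>2 / k * y\<^sup>2"
      using k by (simp add: power2_eq_square field_simps)
    finally show ?thesis
      by (simp add: k_def power2_eq_square algebra_simps)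
  qed
  finally have "pi * (s * (cmod (z - z0))\<^sup>2) \<le> pi * (\<kappa> * x\<^sup>2 + (s + s\<^sup>2 / k) * y\<^sup>2)"
    by (intro mult_left_mono) auto
  hence "exp (pi * s * (cmod (z - z0))\<^sup>2) \<le> exp (pi * ((s + s\<^sup>2 / k) * y\<^sup>2)) * exp (pi * \<kappa> * x\<^sup>2)"
    unfolding exp_add[symmetric] by (simp add: algebra_simps)
  hence "C * exp (pi * s * (cmod (z - z0))\<^sup>2) \<le> C * (exp (pi * ((s + s\<^sup>2 / k) * y\<^sup>2)) * exp (pi * \<kappa> * x\<^sup>2))"
    using C by (rule mult_left_mono)
  with S[of "z - z0"] show "cmod (S (z - z0)) \<le> (C * exp (pi * ((s + s\<^sup>2 / (\<kappa> - s)) * (cmod z0)\<^sup>2))) * exp (pi * \<kappa> * (cmod z)\<^sup>2)"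
    by (simp add: x_def y_def k_def mult.assoc)
qed

text \<open>If the two preimages agreed up to a phase c, then 1 + bS = c (1 - bS) everywhere.
  Comparing two different values of \<open>S\<close> forces c = -1, and then 1 = -1.\<close>

lemma not_retrieval:
  assumes S: "S holomorphic_on UNIV" "\<And>z. cmod (S z) \<le> C * exp (pi * s * (cmod z)\<^sup>2)" "s < 1 / 2"
    and eq: "\<And>t \<omega>. (t, \<omega>) \<in> \<Lambda> \<Longrightarrow>
      cmod (1 + b * S (Complex t (- \<omega>) - z0)) = cmod (1 - b * S (Complex t (- \<omega>) - z0))"
    and b: "b \<noteq> 0" and nonconst: "S u \<noteq> S v"
  shows "\<not> does_gabor_phase_retrieval \<Lambda>"
proof
  assume ret: "does_gabor_phase_retrieval \<Lambda>"
  have C: "C \<ge> 0"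
    using order_trans[OF norm_ge_zero S(2)[of 0]] by simp
  \<comment> \<open>Translating to the centre needs a positive type and costs a little of it. The
    margin up to 1/2 is therefore halved, after raising \<open>s\<close> to at least 1/4.\<close>
  define s' where "s' = max s (1 / 4)"
  have s': "0 < s'" "s' < 1 / 2" "s \<le> s'"
    using S(3) by (auto simp: s'_def)
  define \<kappa> where "\<kappa> = (s' + 1 / 2) / 2"
  have \<kappa>: "s' < \<kappa>" "\<kappa> < 1 / 2" "0 < \<kappa>"
    using s' by (auto simp: \<kappa>_def)
  have S': "cmod (S z) \<le> C * exp (pi * s' * (cmod z)\<^sup>2)" for z
    by (rule order_trans[OF S(2)]) (use C s' in \<open>auto intro!: mult_left_mono mult_right_mono\<close>)
  obtain C' where C': "\<And>z. cmod (S (z - z0)) \<le> C' * exp (pi * \<kappa> * (cmod z)\<^sup>2)"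
    using growth_shift[OF S' s'(1) \<kappa>(1)] by blast
  have preimage: "\<exists>f. square_integrable f \<and> (\<forall>z. bargmann f z = 1 + c * S (z - z0))" for c
  proof (rule bargmann_surjective[OF _ _ \<kappa>(2)])
    have "(S \<circ> (\<lambda>z. z - z0)) holomorphic_on UNIV"
      by (rule holomorphic_on_compose) (auto intro!: holomorphic_intros intro: holomorphic_on_subset[OF S(1)])
    hence "(\<lambda>z. S (z - z0)) holomorphic_on UNIV"
      by (simp add: o_def)
    thus "(\<lambda>z. 1 + c * S (z - z0)) holomorphic_on UNIV"
      by (intro holomorphic_intros)
    show "cmod (1 + c * S (z - z0)) \<le> (1 + cmod c * C') * exp (pi * \<kappa> * (cmod z)\<^sup>2)" for z
    proof -
      define X where "X = exp (pi * \<kappa> * (cmod z)\<^sup>2)"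
      have "1 \<le> X"
        using \<kappa> by (simp add: X_def)
      moreover have "cmod c * cmod (S (z - z0)) \<le> cmod c * (C' * X)"
        unfolding X_def by (intro mult_left_mono C') auto
      moreover have "cmod (1 + c * S (z - z0)) \<le> 1 + cmod c * cmod (S (z - z0))"
        using norm_triangle_ineq[of 1 "c * S (z - z0)"] by (simp add: norm_mult)
      moreover have "(1 + cmod c * C') * X = X + cmod c * (C' * X)"
        by (simp add: algebra_simps)
      ultimately show ?thesis
        unfolding X_def[symmetric] by linarith
    qed
  qed
  obtain f1 where f1: "square_integrable f1" "\<And>z. bargmann f1 z = 1 + b * S (z - z0)"
    using preimage[of b] by blast
  obtain f2 where f2: "square_integrable f2" "\<And>z. bargmann f2 z = 1 - b * S (z - z0)"
    using preimage[of "- b"] by auto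
  have "\<forall>p\<in>\<Lambda>. cmod (gabor f1 p) = cmod (gabor f2 p)"
    using eq by (auto simp: norm_gabor_eq_iff f1 f2)
  then obtain \<alpha> :: real where \<alpha>: "AE x in lebesgue. f1 x = exp (\<i> * \<alpha>) * f2 x"
    using ret f1(1) f2(1) unfolding does_gabor_phase_retrieval_def by blast
  define c where "c = exp (\<i> * of_real \<alpha>)"
  have bargmann_eq: "bargmann f1 z = c * bargmann f2 z" for z
  proof -
    let ?E = "\<lambda>x. exp (- of_real pi * (of_real x)\<^sup>2 + 2 * of_real pi * of_real x * z) :: complex"
    have "(LINT x|lebesgue. f1 x * ?E x) = (LINT x|lebesgue. c * (f2 x * ?E x))"
    proof (rule integral_cong_AE)
      show "(\<lambda>x. f1 x * ?E x) \<in> borel_measurable lebesgue" "(\<lambda>x. c * (f2 x * ?E x)) \<in> borel_measurable lebesgue"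
        using integrable_bargmann[OF f1(1), of z] integrable_bargmann[OF f2(1), of z] by auto
      show "AE x in lebesgue. f1 x * ?E x = c * (f2 x * ?E x)"
        using \<alpha> by eventually_elim (simp add: c_def mult.assoc)
    qed
    thus ?thesis
      unfolding bargmann_def by simp
  qed
  have eq: "1 + b * S z = c * (1 - b * S z)" for z
    using bargmann_eq[of "z + z0"] by (simp add: f1 f2)
  have "(1 + c) * (b * (S u - S v)) = 0"
  proof -
    have "(1 + c) * (b * (S u - S v)) =
        (1 + b * S u - c * (1 - b * S u)) - (1 + b * S v - c * (1 - b * S v))"
      by (simp add: algebra_simps)
    thus ?thesis
      unfolding eq by simp
  qed
  hence "c = -1"
    using b nonconst by (simp add: add_eq_0_iff)
  thus False
    using eq[of u] by (simp add: algebra_simps)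
qed

text \<open>The number 1/4 is just a positive type below 1/2. Bounding x^N by 1 + x^(2N) makes the
  exponent even, so that the single term y^N / N! of exp y with y = pi x^2 / 4 controls it.\<close>

lemma power_growth: "\<exists>C. \<forall>z. cmod (z ^ N) \<le> C * exp (pi * (1 / 4) * (cmod z)\<^sup>2)"
proof (intro exI allI)
  fix z :: complex
  define x where "x = cmod z"
  define y where "y = pi * (1 / 4) * x\<^sup>2"
  have y: "y \<ge> 0" by (simp add: y_def)
  have "0 \<le> (x ^ N - 1)\<^sup>2" "0 \<le> x ^ N"
    by (simp_all add: x_def)
  moreover have "x ^ (2 * N) = (x ^ N)\<^sup>2"
    by (simp add: power_mult[symmetric] mult.commute)
  ultimately have "x ^ N \<le> 1 + x ^ (2 * N)"
    unfolding power2_diff by simp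
  also have "x ^ (2 * N) = (4 / pi) ^ N * y ^ N"
    by (simp add: y_def power_mult flip: power_mult_distrib)
  also have "y ^ N \<le> fact N * exp y"
  proof -
    have "y ^ N / fact N \<le> (\<Sum>n. y ^ n / fact n)"
      using summable_exp[of y] y sum_le_suminf[of "\<lambda>n. y ^ n / fact n" "{N}"] by (simp add: field_simps)
    thus ?thesis
      by (simp add: exp_def field_simps)
  qed
  also have "1 \<le> exp y" using y by simp
  finally have "x ^ N \<le> exp y + (4 / pi) ^ N * (fact N * exp y)"
    by (simp add: mult_left_mono)
  thus "cmod (z ^ N) \<le> (1 + (4 / pi) ^ N * fact N) * exp (pi * (1 / 4) * (cmod z)\<^sup>2)"
    by (simp add: norm_power x_def y_def distrib_right mult.assoc)
qed

theorem theorem4p5: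
  fixes lam :: "nat \<Rightarrow> nat \<Rightarrow> real"
    and a \<theta> :: "nat \<Rightarrow> real"
    and t0 \<omega>0 :: real
    and \<Lambda> :: "(real \<times> real) set"
  assumes incr: "\<And>l. l \<in> {1, 2} \<Longrightarrow> strict_mono_on {1..} (\<lambda>n. lam n l)"
    and pos: "\<And>l n. l \<in> {1, 2} \<Longrightarrow> n \<ge> 1 \<Longrightarrow> lam n l > 0"
    and lim: "\<And>l. l \<in> {1, 2} \<Longrightarrow> (\<lambda>n. lam n l / sqrt (real n)) \<longlonglongrightarrow> a l"
    and ang: "\<And>l. l \<in> {1, 2} \<Longrightarrow> \<theta> l \<in> {0..2 * pi}"
    and Lam: "\<Lambda> = (\<Union>l\<in>{1, 2}.
        {(t0, \<omega>0) + lam n l *\<^sub>R (sin (\<theta> l), cos (\<theta> l)) | n. n \<ge> 1} \<union>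
        {(t0, \<omega>0) - lam n l *\<^sub>R (sin (\<theta> l), cos (\<theta> l)) | n. n \<ge> 1})"
  shows "(max (a 1) (a 2) < 1 \<and> (\<theta> 1 - \<theta> 2) / pi \<notin> \<rat>
            \<longrightarrow> does_gabor_phase_retrieval \<Lambda>)
       \<and> ((\<theta> 1 - \<theta> 2) / pi \<in> \<rat> \<or> inv_square (a 1) + inv_square (a 2) < 1 / 2
            \<longrightarrow> \<not> does_gabor_phase_retrieval \<Lambda>)"
proof (intro conjI impI)
  assume asm: "max (a 1) (a 2) < 1 \<and> (\<theta> 1 - \<theta> 2) / pi \<notin> \<rat>"
  show "does_gabor_phase_retrieval \<Lambda>"
    unfolding does_gabor_phase_retrieval_def
  proof (intro allI impI)
    fix f1 f2
    assume f: "square_integrable f1" "square_integrable f2"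
      and eq: "\<forall>p\<in>\<Lambda>. cmod (gabor f1 p) = cmod (gabor f2 p)"
    show "\<exists>\<alpha>::real. AE x in lebesgue. f1 x = exp (\<i> * \<alpha>) * f2 x"
    proof (rule retrieval_of_two_lines[OF f incr pos lim, where \<theta> = \<theta>])
      show "a l < 1" if "l \<in> {1, 2}" for l
        using asm that by auto
      show "(\<theta> 1 - \<theta> 2) / pi \<notin> \<rat>"
        using asm by simp
      fix l n :: nat assume ln: "l \<in> {1, 2}" "n \<ge> 1"
      have "(t0 + lam n l * sin (\<theta> l), \<omega>0 + lam n l * cos (\<theta> l)) = (t0, \<omega>0) + lam n l *\<^sub>R (sin (\<theta> l), cos (\<theta> l))"
        by simp
      hence "(t0 + lam n l * sin (\<theta> l), \<omega>0 + lam n l * cos (\<theta> l)) \<in> \<Lambda>"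
        unfolding Lam using ln by blast
      thus "cmod (gabor f1 (t0 + lam n l * sin (\<theta> l), \<omega>0 + lam n l * cos (\<theta> l))) =
            cmod (gabor f2 (t0 + lam n l * sin (\<theta> l), \<omega>0 + lam n l * cos (\<theta> l)))"
        using eq by blast
    qed
  qed
next
  define z0 where "z0 = Complex t0 (- \<omega>0)"
  define e where "e = (\<lambda>l. Complex (sin (\<theta> l)) (- cos (\<theta> l)))"
  have e: "cmod (e l) = 1" for l
    by (simp add: e_def direction_cis norm_mult)
  have mem: "\<exists>l\<in>{1, 2}. \<exists>n\<ge>1. Complex t (- \<omega>) - z0 = e l * of_real (lam n l) \<or>
      Complex t (- \<omega>) - z0 = - (e l * of_real (lam n l))" if "(t, \<omega>) \<in> \<Lambda>" for t \<omega>
  proof -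
    from that obtain l n where ln: "l \<in> {1, 2}" "n \<ge> 1" and
      "(t, \<omega>) = (t0, \<omega>0) + lam n l *\<^sub>R (sin (\<theta> l), cos (\<theta> l)) \<or> (t, \<omega>) = (t0, \<omega>0) - lam n l *\<^sub>R (sin (\<theta> l), cos (\<theta> l))"
      unfolding Lam by blast
    hence "Complex t (- \<omega>) - z0 = e l * of_real (lam n l) \<or> Complex t (- \<omega>) - z0 = - (e l * of_real (lam n l))"
      by (auto simp: complex_eq_iff z0_def e_def)
    thus ?thesis
      using ln by blast
  qed
  assume "(\<theta> 1 - \<theta> 2) / pi \<in> \<rat> \<or> inv_square (a 1) + inv_square (a 2) < 1 / 2"
  thus "\<not> does_gabor_phase_retrieval \<Lambda>"
  proof
    assume "(\<theta> 1 - \<theta> 2) / pi \<in> \<rat>"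
    then obtain m k :: int where mk: "k > 0" "(\<theta> 1 - \<theta> 2) / pi = of_int m / of_int k"
      by (auto elim: Rats_cases')
    define N where "N = nat k"
    have N: "real N = of_int k" "N \<noteq> 0"
      using mk(1) by (auto simp: N_def)
    \<comment> \<open>Normalises the first line: \<beta> * e_1^N = 1. On the second line the value
      is exp (- i pi m), a sign, because N is the denominator of the rational angle. Hence \<beta>
      z^N is real on both lines.\<close>
    define \<beta> where "\<beta> = cnj (e 1 ^ N)"
    have ee: "e 1 * cnj (e 1) = 1"
      using e[of 1] complex_norm_square[of "e 1"] by simp
    have \<beta>: "\<beta> * e l ^ N \<in> \<real>" if "l \<in> {1, 2}" for l
    proof (cases "l = 1")
      case True
      thus ?thesis
        using ee by (simp add: \<beta>_def power_mult_distrib[symmetric] mult.commute)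
    next
      case False
      hence l: "l = 2" using that by simp
      have "real N * (\<theta> 2 - \<theta> 1) = - (pi * of_int m)"
        using mk N by (simp add: field_simps)
      hence c: "cis (\<theta> 2 - \<theta> 1) ^ N = cis (- (pi * of_int m))"
        by (simp only: Complex.DeMoivre)
      have "e 2 = e 1 * cis (\<theta> 2 - \<theta> 1)"
        by (simp add: e_def direction_cis cis_mult)
      hence "\<beta> * e l ^ N = (e 1 * cnj (e 1)) ^ N * cis (\<theta> 2 - \<theta> 1) ^ N"
        by (simp add: l \<beta>_def power_mult_distrib)
      also have "\<dots> = cis (- (pi * of_int m))"
        unfolding ee c by simp
      also have "\<dots> \<in> \<real>"
        by (simp add: complex_is_Real_iff sin_zero_iff_int2 mult.commute)
      finally show ?thesis .
    qed
    obtain C where C: "\<And>z. cmod (z ^ N) \<le> C * exp (pi * (1 / 4) * (cmod z)\<^sup>2)"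
      using power_growth by blast
    show ?thesis
    proof (rule not_retrieval[where S = "\<lambda>z. z ^ N" and s = "1 / 4" and b = "\<i> * \<beta>" and ?z0.0 = z0 and u = 0 and v = 1])
      show "cmod (1 + \<i> * \<beta> * (Complex t (- \<omega>) - z0) ^ N) = cmod (1 - \<i> * \<beta> * (Complex t (- \<omega>) - z0) ^ N)"
        if p: "(t, \<omega>) \<in> \<Lambda>" for t \<omega>
      proof -
        define w where "w = Complex t (- \<omega>) - z0"
        obtain l n where l: "l \<in> {1, 2}" and w: "w = e l * of_real (lam n l) \<or> w = - (e l * of_real (lam n l))"
          using mem[OF p] unfolding w_def by blast
        \<comment> \<open>A real parameter of either sign covers both halves of the line at
          once.\<close>
        then obtain r :: real where "w = e l * of_real r"
          by (metis mult_minus_right of_real_minus)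
        hence bw: "\<beta> * w ^ N = (\<beta> * e l ^ N) * of_real (r ^ N)"
          by (simp add: power_mult_distrib)
        have "\<beta> * w ^ N \<in> \<real>"
          unfolding bw by (intro Reals_mult Reals_of_real \<beta>[OF l])
        then obtain \<rho> where \<rho>: "\<beta> * w ^ N = of_real \<rho>"
          by (elim Reals_cases)
        have "cmod (1 + \<i> * of_real \<rho>) = cmod (1 - \<i> * of_real \<rho>)"
          by (simp add: cmod_def)
        thus ?thesis
          unfolding w_def[symmetric] mult.assoc \<rho> .
      qed
      show "\<i> * \<beta> \<noteq> 0"
        using e[of 1] by (auto simp: \<beta>_def)
    qed (use C N in \<open>auto intro!: holomorphic_intros simp: zero_power\<close>)
  next
    assume inv: "inv_square (a 1) + inv_square (a 2) < 1 / 2"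
    \<comment> \<open>A vanishing limit would make the sum infinite by the convention for
      \<open>inv_square\<close>.\<close>
    have nz: "a 1 \<noteq> 0" "a 2 \<noteq> 0"
      using inv by (auto simp: inv_square_def split: if_splits)
    define s0 where "s0 = 1 / (a 1)\<^sup>2 + 1 / (a 2)\<^sup>2"
    have "ereal s0 < ereal (1 / 2)"
      using inv nz by (simp add: inv_square_def s0_def one_ereal_def)
    hence s0: "s0 < 1 / 2" "s0 > 0"
      using nz by (auto simp: s0_def intro!: add_pos_pos)
    \<comment> \<open>The midpoint of 2 s0 and 1: r < 1 makes each \<open>q l\<close> smaller than
      (a l)^2, as the products require, and r > 2 s0 keeps the combined type 1 / q_1 + 1 / q_2 = s0
      / r below 1/2.\<close>
    define r where "r = (1 + 2 * s0) / 2"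
    have r: "0 < r" "r < 1" "s0 / r < 1 / 2"
      using s0 by (auto simp: r_def field_simps)
    define q where "q = (\<lambda>l. (a l)\<^sup>2 * r)"
    have ql: "0 < q l" "q l < (a l)\<^sup>2" if "l \<in> {1, 2}" for l
      using that nz r by (auto simp: q_def)
    have "\<exists>S C. S holomorphic_on UNIV \<and> S 0 = 1 \<and> (\<forall>z. cmod (S z) \<le> C * exp (pi * (1 / q l) * (cmod z)\<^sup>2)) \<and>
        (\<forall>n\<ge>1. S (e l * of_real (lam n l)) = 0 \<and> S (- (e l * of_real (lam n l))) = 0)" if "l \<in> {1, 2}" for l
      using quartic_product[OF pos lim ql e] that by blast
    then obtain S C where S: "\<And>l. l \<in> {1, 2} \<Longrightarrow> S l holomorphic_on UNIV" "\<And>l. l \<in> {1, 2} \<Longrightarrow> S l 0 = 1"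
      "\<And>l z. l \<in> {1, 2} \<Longrightarrow> cmod (S l z) \<le> C l * exp (pi * (1 / q l) * (cmod z)\<^sup>2)"
      "\<And>l n. l \<in> {1, 2} \<Longrightarrow> n \<ge> 1 \<Longrightarrow> S l (e l * of_real (lam n l)) = 0 \<and> S l (- (e l * of_real (lam n l))) = 0"
      by metis
    define T where "T = (\<lambda>z. S 1 z * S 2 z)"
    show ?thesis
    \<comment> \<open>On the sampling set one of the two factors vanishes, so both transforms equal
      1 there. \<open>T\<close> is not constant: it is 1 at the origin and 0 at the first sampling
      point.\<close>
    proof (rule not_retrieval[where S = T and s = "s0 / r" and b = 1 and ?z0.0 = z0 and u = 0 and v = "e 1 * of_real (lam 1 1)"])
      show "T holomorphic_on UNIV"
        unfolding T_def using S(1) by (intro holomorphic_intros) auto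
      show "cmod (T z) \<le> (C 1 * C 2) * exp (pi * (s0 / r) * (cmod z)\<^sup>2)" for z
      proof -
        have "cmod (T z) \<le> (C 1 * exp (pi * (1 / q 1) * (cmod z)\<^sup>2)) * (C 2 * exp (pi * (1 / q 2) * (cmod z)\<^sup>2))"
          unfolding T_def norm_mult using S(3)[of 1 z] S(3)[of 2 z]
          by (intro mult_mono) (auto intro: order_trans[OF norm_ge_zero])
        also have "\<dots> = (C 1 * C 2) * (exp (pi * (1 / q 1) * (cmod z)\<^sup>2) * exp (pi * (1 / q 2) * (cmod z)\<^sup>2))"
          by simp
        also have "exp (pi * (1 / q 1) * (cmod z)\<^sup>2) * exp (pi * (1 / q 2) * (cmod z)\<^sup>2) = exp (pi * (1 / q 1 + 1 / q 2) * (cmod z)\<^sup>2)"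
          by (simp add: exp_add[symmetric] algebra_simps)
        also have "1 / q 1 + 1 / q 2 = s0 / r"
          by (simp add: q_def s0_def add_divide_distrib)
        finally show ?thesis .
      qed
      show "cmod (1 + 1 * T (Complex t (- \<omega>) - z0)) = cmod (1 - 1 * T (Complex t (- \<omega>) - z0))"
        if p: "(t, \<omega>) \<in> \<Lambda>" for t \<omega>
      proof -
        have "T (Complex t (- \<omega>) - z0) = 0"
          using mem[OF p] S(4) by (auto simp: T_def)
        thus ?thesis by simp
      qed
      show "T 0 \<noteq> T (e 1 * of_real (lam 1 1))"
        using S(2,4) by (simp add: T_def)
    qed (use r in auto)
  qed
qed

end
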